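(* Let $\mathcal{G}$ be a bounded-degree Borel pmp graph on a standard probability space $(X,\mu)$. Then $\chi_\mu^{\mathrm{ap}}(\mathcal{G})\le\lfloor M(T_{\mathcal{G}})\rfloor+1$.
   Context: A Borel graph on $X$ is a simple undirected graph with Borel edge set in $X^2$; bounded degree means there is $d$ with $\deg(x)\le d$ for (almost) all $x$. $\mathcal{G}$ is pmp if every partial Borel bijection of $X$ whose graph is contained in the connectedness relation of $\mathcal{G}$ preserves $\mu$. $T_{\mathcal{G}}$ is the adjacency operator on $L^2(X,\mu)$, $(T_{\mathcal{G}}f)(x)=\sum_{y\sim x}f(y)$, and $M(T_{\mathcal{G}})=\sup_{f\neq0}\langle T_{\mathcal{G}}f,f\rangle/\langle f,f\rangle$ (the maximum of the spectrum). $\chi_\mu^{\mathrm{ap}}(\mathcal{G})$ is the least $k$ such that for every $\varepsilon>0$ there is a Borel $A\subseteq X$ with $\mu(A)>1-\varepsilon$ such that $\mathcal{G}\restriction A$ admits a $\mu$-measurable proper $k$-coloring. *)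

theory Defs
  imports "HOL-Probability.Probability"
begin

definition standard_prob_space :: "'a::polish_space measure \<Rightarrow> bool" where
  "standard_prob_space M \<longleftrightarrow> prob_space M \<and> sets M = sets (borel :: 'a measure)"

definition borel_graph :: "('a::polish_space \<Rightarrow> 'a \<Rightarrow> bool) \<Rightarrow> bool" where
  "borel_graph E \<longleftrightarrow> (\<forall>x y. E x y \<longrightarrow> E y x) \<and> (\<forall>x. \<not> E x x) \<and>
     {(x, y). E x y} \<in> sets (borel :: ('a \<times> 'a) measure)"

definition degree :: "('a \<Rightarrow> 'a \<Rightarrow> bool) \<Rightarrow> 'a \<Rightarrow> enat" where
  "degree E x = (if finite {y. E x y} then enat (card {y. E x y}) else \<infinity>)"

definition bounded_degree :: "'a measure \<Rightarrow> ('a \<Rightarrow> 'a \<Rightarrow> bool) \<Rightarrow> bool" where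
  "bounded_degree M E \<longleftrightarrow> (\<exists>d::nat. AE x in M. degree E x \<le> enat d)"

definition partial_borel_bijection :: "'a measure \<Rightarrow> 'a set \<Rightarrow> ('a \<Rightarrow> 'a) \<Rightarrow> bool" where
  "partial_borel_bijection M D f \<longleftrightarrow> D \<in> sets M \<and> f ` D \<in> sets M \<and> inj_on f D \<and>
     f \<in> measurable (restrict_space M D) M \<and>
     the_inv_into D f \<in> measurable (restrict_space M (f ` D)) M"

definition pmp_graph :: "'a measure \<Rightarrow> ('a \<Rightarrow> 'a \<Rightarrow> bool) \<Rightarrow> bool" where
  "pmp_graph M E \<longleftrightarrow> (\<forall>D f. partial_borel_bijection M D f \<and> (\<forall>x\<in>D. E\<^sup>*\<^sup>* x (f x)) \<longrightarrow>
     (\<forall>A. A \<in> sets M \<and> A \<subseteq> D \<longrightarrow> emeasure M (f ` A) = emeasure M A))"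

definition adj_op :: "('a \<Rightarrow> 'a \<Rightarrow> bool) \<Rightarrow> ('a \<Rightarrow> real) \<Rightarrow> 'a \<Rightarrow> real" where
  "adj_op E f x = (\<Sum>y\<in>{y. E x y}. f y)"

definition L2_nonzero :: "'a measure \<Rightarrow> ('a \<Rightarrow> real) set" where
  "L2_nonzero M = {f. f \<in> borel_measurable M \<and> integrable M (\<lambda>x. (f x)\<^sup>2) \<and> \<not> (AE x in M. f x = 0)}"

definition max_spec :: "'a measure \<Rightarrow> ('a \<Rightarrow> 'a \<Rightarrow> bool) \<Rightarrow> real" where
  "max_spec M E = Sup {(\<integral>x. adj_op E f x * f x \<partial>M) / (\<integral>x. (f x)\<^sup>2 \<partial>M) | f. f \<in> L2_nonzero M}"

definition meas_proper_coloring :: "'a measure \<Rightarrow> ('a \<Rightarrow> 'a \<Rightarrow> bool) \<Rightarrow> 'a set \<Rightarrow> nat \<Rightarrow> bool" where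
  "meas_proper_coloring M E A k \<longleftrightarrow> (\<exists>c::'a \<Rightarrow> nat.
     c \<in> measurable (restrict_space (completion M) A) (count_space UNIV) \<and>
     (\<forall>x\<in>A. c x < k) \<and> (\<forall>x\<in>A. \<forall>y\<in>A. E x y \<longrightarrow> c x \<noteq> c y))"

definition ap_colorable :: "'a measure \<Rightarrow> ('a \<Rightarrow> 'a \<Rightarrow> bool) \<Rightarrow> nat \<Rightarrow> bool" where
  "ap_colorable M E k \<longleftrightarrow> (\<forall>\<epsilon>>0. \<exists>A. A \<in> sets M \<and> measure M A > 1 - \<epsilon> \<and>
      meas_proper_coloring M E A k)"

definition chi_ap :: "'a measure \<Rightarrow> ('a \<Rightarrow> 'a \<Rightarrow> bool) \<Rightarrow> nat" where
  "chi_ap M E = (LEAST k. ap_colorable M E k)"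

end

theory Submission
  imports Defs
begin

text \<open>For a Borel set \<open>A\<close> of positive measure, the Rayleigh quotient of its indicator function is the average
  degree of the graph restricted to \<open>A\<close>. It is at most \<open>M(T)\<close>, so a fraction of \<open>A\<close> bounded away from zero
  has degree less than \<open>k = \<lfloor>M(T)\<rfloor> + 1\<close> inside \<open>A\<close>. Removing these vertices again and again exhausts the space
  up to a set of small measure, and the removed layers are coloured greedily in reverse order, one
  Borel independent set at a time. This is Wilf's argument for finite graphs.

  The analytic work is in two places. Neighbourhoods have to be enumerated by Borel functions;
  modulo a null set this follows from Choquet's capacitability theorem, which exhausts a Borel set with
  finite sections by compact sets. And the Rayleigh quotients have to be bounded above, which is where
  measure preservation enters. The degree bound holds only almost everywhere, and \<open>L\<^sup>2\<close> functions may take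
  arbitrary values on a null set, so one needs in particular that almost no vertex has a neighbour in
  a given null set, although vertices in the null set may have uncountably many neighbours.\<close>


section \<open>Capacitability of projections\<close>

text \<open>Invariance is assumed only for partial bijections with Borel domain, image and inverse.
  An injection found along the edges does not come with a Borel image or inverse. If its graph is
  compact, both are automatic, since the map and its inverse are continuous between compact sets. So
  before neighbours are enumerated, measures are compared through compact subsets of graphs, and
  capacitability makes these subsets large enough. Once neighbours are enumerated, the inverse of an
  enumerating function is piecewise another such function, and invariance applies directly. For this
  the exceptional null set must be closed under taking neighbours; otherwise an edge from its
  complement may lack an enumerated reverse.

  The strictness of \<open>k > M(T)\<close> is what makes the pruning effective: each round
  multiplies the measure by at most \<open>M(T)/k < 1\<close>, so finitely many rounds reach any
  prescribed error.\<close>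

lemma open_eq_UN_closed:
  fixes U :: "'a::metric_space set"
  assumes "open U"
  obtains C :: "nat \<Rightarrow> 'a set" where "\<And>n. closed (C n)" "U = (\<Union>n. C n)"
proof -
  have "fsigma_in euclidean U"
    using open_imp_fsigma_in[OF metrizable_space_euclidean] assms by auto
  then obtain C where "\<And>n::nat. closed (C n)" "U = \<Union>(range C)"
    unfolding fsigma_in_ascending by auto
  then show thesis using that by blast
qed

text \<open>Suslin sets as projections of closed sets along a space of sequences. A real sequence
  has room to code countably many witnesses, and \<open>nat \<Rightarrow> real\<close> is Polish, as
  the capacitability argument requires.\<close>

definition analytic :: "'z::topological_space set \<Rightarrow> bool" where
  "analytic R \<longleftrightarrow> (\<exists>C::((nat \<Rightarrow> real) \<times> 'z) set. closed C \<and> snd ` C = R)"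

lemma continuous_on_coord_fst:
  "continuous_on UNIV (\<lambda>p::((nat \<Rightarrow> real) \<times> 'z::topological_space). fst p n)"
  by (rule continuous_on_product_then_coordinatewise) (intro continuous_intros)

text \<open>Coordinate 0 of the witness names the index \<open>n\<close>; the shifted sequence is a
  witness for \<open>R n\<close>.\<close>

lemma analytic_UN:
  fixes R :: "nat \<Rightarrow> 'z::topological_space set"
  assumes "\<And>n. analytic (R n)"
  shows "analytic (\<Union>n. R n)"
proof -
  have "\<forall>n. \<exists>C::((nat \<Rightarrow> real) \<times> 'z) set. closed C \<and> snd ` C = R n"
    using assms unfolding analytic_def by blast
  then obtain C :: "nat \<Rightarrow> ((nat \<Rightarrow> real) \<times> 'z) set"
    where C: "\<And>n. closed (C n)" "\<And>n. snd ` C n = R n"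
    by metis
  define sh where "sh = (\<lambda>p::((nat \<Rightarrow> real) \<times> 'z). (\<lambda>k. fst p (Suc k), snd p))"
  have sh: "continuous_on UNIV sh"
    unfolding sh_def
    by (intro continuous_on_Pair continuous_on_coordinatewise_then_product continuous_on_coord_fst
          continuous_on_snd continuous_on_id)
  \<comment> \<open>For a natural number in coordinate 0, distance less than 1 from \<open>n\<close>
    means equality. This form of the implication is a closed condition.\<close>
  define D where "D = {p. fst p 0 \<in> \<nat>} \<inter> (\<Inter>n. {p. \<bar>fst p 0 - real n\<bar> \<ge> 1} \<union> (sh -` C n))"
  have "closed ((\<lambda>p::((nat \<Rightarrow> real) \<times> 'z). fst p 0) -` \<nat>)"
    by (intro closed_vimage closed_Nats continuous_on_coord_fst)
  moreover have "closed {p::((nat \<Rightarrow> real) \<times> 'z). \<bar>fst p 0 - real n\<bar> \<ge> 1}" for n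
    by (intro closed_Collect_le continuous_intros continuous_on_coord_fst)
  ultimately have "closed D"
    unfolding D_def by (intro closed_Int closed_INT ballI closed_Un closed_vimage[OF C(1) sh])
      (auto simp: vimage_def)
  moreover have "snd ` D = (\<Union>n. R n)"
  proof safe
    fix w z assume D: "(w, z) \<in> D"
    then obtain n where n: "w 0 = real n" unfolding D_def by (auto elim: Nats_cases)
    with D have "sh (w, z) \<in> C n" unfolding D_def by (auto dest: spec[of _ n])
    then have "snd (sh (w,z)) \<in> R n" using C(2) by (metis imageI)
    then show "snd (w, z) \<in> (\<Union>n. R n)" by (auto simp: sh_def)
  next
    fix n z assume "z \<in> R n"
    then obtain w where w: "(w, z) \<in> C n" using C(2)[of n] by force
    have "1 \<le> \<bar>real n - real m\<bar>" if "n \<noteq> m" for m using that by linarith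
    then have "(case_nat (real n) w, z) \<in> D" unfolding D_def sh_def using w by fastforce
    then show "z \<in> snd ` D" by force
  qed
  ultimately show ?thesis unfolding analytic_def by blast
qed

text \<open>A single sequence, read as a matrix through \<open>prod_encode\<close>, carries in row
  \<open>n\<close> a witness for \<open>R n\<close>.\<close>

lemma analytic_INT:
  fixes R :: "nat \<Rightarrow> 'z::topological_space set"
  assumes "\<And>n. analytic (R n)"
  shows "analytic (\<Inter>n. R n)"
proof -
  have "\<forall>n. \<exists>C::((nat \<Rightarrow> real) \<times> 'z) set. closed C \<and> snd ` C = R n"
    using assms unfolding analytic_def by blast
  then obtain C :: "nat \<Rightarrow> ((nat \<Rightarrow> real) \<times> 'z) set"
    where C: "\<And>n. closed (C n)" "\<And>n. snd ` C n = R n"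
    by metis
  define sh where "sh n = (\<lambda>p::((nat \<Rightarrow> real) \<times> 'z). (\<lambda>k. fst p (prod_encode (n, k)), snd p))" for n
  have sh: "continuous_on UNIV (sh n)" for n
    unfolding sh_def
    by (intro continuous_on_Pair continuous_on_coordinatewise_then_product continuous_on_coord_fst
          continuous_on_snd continuous_on_id)
  define D where "D = (\<Inter>n. sh n -` C n)"
  have "closed D"
    unfolding D_def by (intro closed_INT ballI closed_vimage[OF C(1) sh])
  moreover have "snd ` D = (\<Inter>n. R n)"
  proof safe
    fix w z n assume "(w, z) \<in> D"
    then have "sh n (w, z) \<in> C n" unfolding D_def by auto
    then have "snd (sh n (w,z)) \<in> R n" using C(2) by (metis imageI)
    then show "snd (w, z) \<in> R n" by (auto simp: sh_def)
  next
    fix z assume "z \<in> (\<Inter>n. R n)"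
    then have "\<forall>n. \<exists>w. (w, z) \<in> C n" using C(2) by force
    then obtain w where w: "\<And>n. (w n, z) \<in> C n" by metis
    have "(\<lambda>k. w (fst (prod_decode k)) (snd (prod_decode k)), z) \<in> D"
      unfolding D_def sh_def using w by auto
    then show "z \<in> snd ` D" by force
  qed
  ultimately show ?thesis unfolding analytic_def by blast
qed

lemma closed_imp_analytic: "closed C \<Longrightarrow> analytic C"
  unfolding analytic_def by (rule exI[of _ "UNIV \<times> C"]) (auto intro: closed_Times)

lemma open_imp_analytic:
  fixes U :: "'z::metric_space set"
  assumes "open U"
  shows "analytic U"
  using open_eq_UN_closed[OF assms] analytic_UN closed_imp_analytic by metis

text \<open>Complements of analytic sets need not be analytic, so the induction over the Borel sets carries
  the complement along.\<close>

lemma borel_imp_analytic: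
  fixes R :: "'z::metric_space set"
  assumes "R \<in> sets borel"
  shows "analytic R"
proof -
  have "R \<in> sigma_sets UNIV {S. open S}"
    using assms by (simp add: sets_borel)
  then have "analytic R \<and> analytic (- R)"
  proof induction
    case (Basic a)
    then show ?case by (simp add: open_imp_analytic closed_imp_analytic closed_Compl)
  next
    case Empty
    then show ?case by (simp add: closed_imp_analytic)
  next
    case (Compl a)
    then show ?case by (simp add: Compl_eq_Diff_UNIV[symmetric])
  next
    case (Union a)
    then show ?case by (simp add: analytic_UN analytic_INT Compl_UN)
  qed
  then show ?thesis ..
qed

text \<open>The \<open>C m\<close> need not be compact, yet they behave like a decreasing sequence
  of compact sets. Points chosen from \<open>C m\<close> outside \<open>V\<close> form a totally
  bounded sequence, because each \<open>C m\<close> contains all but finitely many of them. A limit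
  point lies in every \<open>C m\<close>, hence in the open set \<open>V\<close>, and so do later
  terms.\<close>

lemma totally_bounded_cuts:
  fixes C :: "nat \<Rightarrow> 'w::complete_space set"
  assumes cl: "\<And>m. closed (C m)" and dec: "decseq C"
    and tb: "\<And>m. \<exists>F. finite F \<and> C (Suc m) \<subseteq> (\<Union>x\<in>F. cball x (1 / Suc m))"
  shows "compact (\<Inter>m. C m)"
    and "\<And>V. open V \<Longrightarrow> (\<Inter>m. C m) \<subseteq> V \<Longrightarrow> \<exists>m. C m \<subseteq> V"
proof -
  have small: "\<exists>m F. finite F \<and> C m \<subseteq> (\<Union>x\<in>F. ball x e)" if "e > 0" for e :: real
  proof -
    obtain m where m: "1 / real (Suc m) < e" using \<open>e > 0\<close> nat_approx_posE by blast
    obtain F where "finite F" "C (Suc m) \<subseteq> (\<Union>x\<in>F. cball x (1 / Suc m))" using tb by blast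
    moreover have "cball x (1 / Suc m) \<subseteq> ball x e" for x :: 'w using m by auto
    ultimately show ?thesis by (intro exI[of _ "Suc m"] exI[of _ F]) blast
  qed
  show "compact (\<Inter>m. C m)"
    unfolding compact_eq_totally_bounded
  proof (intro conjI allI impI)
    show "Topological_Spaces.complete (\<Inter>m. C m)" by (simp add: complete_eq_closed cl closed_INT)
    fix e :: real assume "e > 0"
    with small obtain m F where "finite F" "C m \<subseteq> (\<Union>x\<in>F. ball x e)" by blast
    then show "\<exists>k. finite k \<and> (\<Inter>m. C m) \<subseteq> (\<Union>x\<in>k. ball x e)" by blast
  qed
  fix V assume V: "open V" "(\<Inter>m. C m) \<subseteq> V"
  show "\<exists>m. C m \<subseteq> V"
  proof (rule ccontr)
    assume "\<nexists>m. C m \<subseteq> V"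
    then have "\<forall>m. \<exists>w. w \<in> C m \<and> w \<notin> V" by blast
    then obtain w where w: "\<And>m. w m \<in> C m" "\<And>m. w m \<notin> V" by metis
    have "compact (closure (range w))"
      unfolding compact_eq_totally_bounded
    proof (intro conjI allI impI)
      show "Topological_Spaces.complete (closure (range w))" by (simp add: complete_eq_closed)
      fix e :: real assume "e > 0"
      then obtain m F where F: "finite F" "C m \<subseteq> (\<Union>x\<in>F. ball x (e/2))"
        using small[of "e/2"] by auto
      have "range w \<subseteq> (\<Union>x\<in>F \<union> w ` {..<m}. cball x (e/2))"
      proof
        fix y assume "y \<in> range w"
        then obtain i where i: "y = w i" by blast
        show "y \<in> (\<Union>x\<in>F \<union> w ` {..<m}. cball x (e/2))"
        proof (cases "i < m")
          case True
          then show ?thesis using \<open>e > 0\<close> i by (intro UN_I[of "w i"]) auto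
        next
          case False
          then have "y \<in> C m" using w(1)[of i] decseqD[OF dec, of m i] i by auto
          then have "y \<in> (\<Union>x\<in>F. ball x (e/2))" using F(2) by blast
          then show ?thesis using ball_subset_cball by blast
        qed
      qed
      moreover have "closed (\<Union>x\<in>F \<union> w ` {..<m}. cball x (e/2))"
        using F(1) by (intro closed_UN) auto
      ultimately have "closure (range w) \<subseteq> (\<Union>x\<in>F \<union> w ` {..<m}. cball x (e/2))"
        by (rule closure_minimal)
      also have "\<dots> \<subseteq> (\<Union>x\<in>F \<union> w ` {..<m}. ball x e)"
        using \<open>e > 0\<close> by (intro UN_mono) auto
      finally show "\<exists>k. finite k \<and> closure (range w) \<subseteq> (\<Union>x\<in>k. ball x e)"
        using F(1) by (intro exI[of _ "F \<union> w ` {..<m}"]) auto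
    qed
    then have "seq_compact (closure (range w))" by (simp add: compact_eq_seq_compact_metric)
    then obtain l r where r: "strict_mono (r::nat\<Rightarrow>nat)" "(w \<circ> r) \<longlonglongrightarrow> l"
      unfolding seq_compact_def using closure_subset[of "range w"] by (metis range_subsetD)
    have "l \<in> C m" for m
    proof (rule Lim_in_closed_set[OF cl _ _ r(2)])
      show "\<forall>\<^sub>F n in sequentially. (w \<circ> r) n \<in> C m"
        using eventually_ge_at_top[of m]
      proof eventually_elim
        case (elim n)
        then have "m \<le> r n" using seq_suble[OF r(1), of n] by linarith
        then show ?case using w(1)[of "r n"] decseqD[OF dec, of m "r n"] by auto
      qed
    qed auto
    then have "l \<in> V" using V(2) by blast
    then have "\<forall>\<^sub>F n in sequentially. (w \<circ> r) n \<in> V"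
      using topological_tendstoD[OF r(2) V(1)] by blast
    then show False using w(2) by (auto simp: eventually_sequentially)
  qed
qed

lemma finite_cball_cover:
  obtains D :: "nat \<Rightarrow> nat \<Rightarrow> 'w::{metric_space,second_countable_topology} set"
  where "\<And>m. incseq (D m)" "\<And>m. (\<Union>j. D m j) = UNIV" "\<And>m j. closed (D m j)"
    "\<And>m j. \<exists>F. finite F \<and> D m j = (\<Union>x\<in>F. cball x (1 / Suc m))"
proof -
  obtain e :: "nat \<Rightarrow> 'w" where e: "\<And>X. open X \<Longrightarrow> X \<noteq> {} \<Longrightarrow> \<exists>n. e n \<in> X"
  proof -
    obtain S :: "'w set" where S: "countable S" "\<And>X. open X \<Longrightarrow> X \<noteq> {} \<Longrightarrow> \<exists>d\<in>S. d \<in> X"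
      using countable_dense_setE by blast
    then have "S \<noteq> {}" by (metis UNIV_not_empty empty_iff open_UNIV)
    then show thesis using that[of "from_nat_into S"] S by (metis from_nat_into_surj)
  qed
  define D where "D m j = (\<Union>x\<in>e ` {..j}. cball x (1 / Suc m))" for m j
  show thesis
  proof (rule that)
    show "incseq (D m)" for m unfolding D_def incseq_def by fastforce
    show "closed (D m j)" for m j unfolding D_def by (intro closed_UN) auto
    show "\<exists>F. finite F \<and> D m j = (\<Union>x\<in>F. cball x (1 / Suc m))" for m j
      unfolding D_def by blast
    show "(\<Union>j. D m j) = UNIV" for m
    proof safe
      fix x :: 'w
      have "\<exists>n. e n \<in> ball x (1 / Suc m)" by (rule e) auto
      then obtain n where "e n \<in> ball x (1 / Suc m)" ..
      then have "x \<in> D m n" unfolding D_def by (auto simp: dist_commute intro!: bexI[of _ n])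
      then show "x \<in> (\<Union>j. D m j)" by blast
    qed simp
  qed
qed

text \<open>Choquet's argument. Outer measure is continuous along increasing sequences of arbitrary
  sets, so \<open>C\<close> can be cut successively by finite unions of smaller and smaller balls
  while the image keeps outer measure above \<open>r\<close>. The cuts meet in a compact
  \<open>K\<close>. An open set around the image of \<open>K\<close> already contains the image of
  some cut, and outer regularity concludes, with a weak inequality in the limit.\<close>

lemma closed_image_capacitable:
  fixes M :: "'a::polish_space measure" and C :: "'w::{complete_space,second_countable_topology} set"
  assumes fin: "emeasure M (space M) \<noteq> \<infinity>" and sb: "sets M = sets borel"
    and C: "closed C" and g: "continuous_on UNIV (g :: 'w \<Rightarrow> 'a)"
    and r: "r < outer_measure_of M (g ` C)"
  shows "\<exists>K. compact K \<and> K \<subseteq> C \<and> r \<le> emeasure M (g ` K)"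
proof -
  have sp: "space M = UNIV" using sets_eq_imp_space_eq[OF sb] by simp
  obtain D :: "nat \<Rightarrow> nat \<Rightarrow> 'w set" where D: "\<And>m. incseq (D m)" "\<And>m. (\<Union>j. D m j) = UNIV"
     "\<And>m j. closed (D m j)" "\<And>m j. \<exists>F. finite F \<and> D m j = (\<Union>x\<in>F. cball x (1 / Suc m))"
    using finite_cball_cover by blast
  define P where "P m B \<longleftrightarrow> closed B \<and> B \<subseteq> C \<and> r < outer_measure_of M (g ` B)" for m :: nat and B
  have "\<exists>B. \<forall>m. P m (B m) \<and> (B (Suc m) \<subseteq> B m \<and> (\<exists>j. B (Suc m) \<subseteq> D m j))"
  proof (rule dependent_nat_choice)
    show "\<exists>B. P 0 B" using C r unfolding P_def by blast
    fix B m assume B: "P m B"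
    have "(SUP j. outer_measure_of M (g ` (B \<inter> D m j))) = outer_measure_of M (\<Union>j. g ` (B \<inter> D m j))"
      using D(1)[of m] by (intro SUP_outer_measure_of_incseq) (auto simp: sp incseq_def)
    also have "(\<Union>j. g ` (B \<inter> D m j)) = g ` B" using D(2)[of m] by blast
    finally have "r < (SUP j. outer_measure_of M (g ` (B \<inter> D m j)))" using B P_def by simp
    then obtain j where "r < outer_measure_of M (g ` (B \<inter> D m j))" by (auto simp: less_SUP_iff)
    then show "\<exists>B'. P (Suc m) B' \<and> (B' \<subseteq> B \<and> (\<exists>j. B' \<subseteq> D m j))"
      using B D(3) by (intro exI[of _ "B \<inter> D m j"]) (auto simp: P_def)
  qed
  then obtain B where B: "\<And>m. P m (B m)" "\<And>m. B (Suc m) \<subseteq> B m" "\<And>m. \<exists>j. B (Suc m) \<subseteq> D m j"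
    by blast
  define K where "K = (\<Inter>m. B m)"
  have cl: "\<And>m. closed (B m)" and dec: "decseq B"
    using B unfolding P_def by (auto intro!: decseq_SucI)
  have tb: "\<exists>F. finite F \<and> B (Suc m) \<subseteq> (\<Union>x\<in>F. cball x (1 / Suc m))" for m
    using B(3)[of m] D(4) by metis
  note cuts = totally_bounded_cuts[OF cl dec tb]
  have K: "compact K" unfolding K_def by (rule cuts(1))
  have "compact (g ` K)" using K g compact_continuous_image continuous_on_subset by blast
  then have gK: "g ` K \<in> sets borel" by (simp add: compact_imp_closed)
  have "r \<le> emeasure M (g ` K)"
    unfolding outer_regular[OF sb fin gK]
  proof (rule INF_greatest, safe)
    fix U :: "'a set" assume U: "g ` K \<subseteq> U" "open U"
    have "open (g -` U)" using g U(2) open_vimage by blast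
    moreover have "(\<Inter>m. B m) \<subseteq> g -` U" using U(1) K_def by blast
    ultimately obtain m where m: "B m \<subseteq> g -` U" using cuts(2) by blast
    have "r < outer_measure_of M (g ` B m)" using B(1) P_def by blast
    also have "\<dots> \<le> outer_measure_of M U" using m by (intro outer_measure_of_mono) auto
    also have "\<dots> = emeasure M U" using U(2) by (intro outer_measure_of_eq) (simp add: sb)
    finally show "r \<le> emeasure M U" by simp
  qed
  moreover have "K \<subseteq> C" using B(1) unfolding K_def P_def by blast
  ultimately show ?thesis using K by blast
qed

text \<open>The projection of \<open>R\<close> is a continuous image of a closed set under two
  successive projections. Stopping after the first one places the compact set inside
  \<open>R\<close> itself, not merely inside its projection.\<close>

lemma borel_fst_capacitable:
  fixes M :: "'a::polish_space measure" and R :: "('a \<times> 'y::{complete_space,second_countable_topology}) set"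
  assumes fin: "emeasure M (space M) \<noteq> \<infinity>" and sb: "sets M = sets borel"
    and R: "R \<in> sets borel" and r: "r < outer_measure_of M (fst ` R)"
  shows "\<exists>K. compact K \<and> K \<subseteq> R \<and> r \<le> emeasure M (fst ` K)"
proof -
  obtain C :: "((nat \<Rightarrow> real) \<times> ('a \<times> 'y)) set" where C: "closed C" "snd ` C = R"
    using borel_imp_analytic[OF R] unfolding analytic_def by blast
  have eq: "(\<lambda>p. fst (snd p)) ` S = fst ` snd ` S" for S :: "((nat \<Rightarrow> real) \<times> ('a \<times> 'y)) set"
    by (simp add: image_image)
  have "continuous_on UNIV (\<lambda>p::((nat \<Rightarrow> real) \<times> ('a \<times> 'y)). fst (snd p))"
    by (intro continuous_intros)
  from closed_image_capacitable[OF fin sb C(1) this] obtain K where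
    "compact K" "K \<subseteq> C" "r \<le> emeasure M (fst ` snd ` K)" using r C(2) unfolding eq by auto
  then show ?thesis using C(2)
    by (intro exI[of _ "snd ` K"])
      (auto intro!: compact_continuous_image continuous_intros simp del: image_eqI)
qed


section \<open>Bijections along a pmp graph\<close>

text \<open>The preimage of a closed set is the projection of a compact piece of the graph, hence
  closed.\<close>

lemma compact_graph_continuous_on:
  fixes G :: "('a::metric_space \<times> 'y::metric_space) set"
  assumes G: "compact G" and f: "\<And>x y. (x, y) \<in> G \<Longrightarrow> y = f x"
  shows "continuous_on (fst ` G) f"
proof -
  have cpt: "compact (fst ` (G \<inter> UNIV \<times> B))" if "closed B" for B
    using that G by (intro compact_continuous_image continuous_intros compact_Int_closed closed_Times) auto
  have "closed (fst ` G)" using cpt[of UNIV] by (auto intro: compact_imp_closed)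
  moreover have "closed (f -` B \<inter> fst ` G)" if "closed B" for B
  proof -
    have "f -` B \<inter> fst ` G = fst ` (G \<inter> UNIV \<times> B)" using f by force
    then show ?thesis using cpt[OF that] by (simp add: compact_imp_closed)
  qed
  ultimately show ?thesis by (simp add: continuous_on_closed_vimage)
qed

lemma borel_graph_of_function:
  fixes \<psi> :: "'a::second_countable_topology \<Rightarrow> 'y::{metric_space,second_countable_topology}"
  assumes [measurable]: "\<psi> \<in> borel_measurable borel" "D \<in> sets borel"
  shows "{p. fst p \<in> D \<and> snd p = \<psi> (fst p)} \<in> sets borel"
proof -
  have "{p \<in> space (borel \<Otimes>\<^sub>M borel). fst p \<in> D \<and> dist (snd p) (\<psi> (fst p)) = 0} \<in> sets (borel \<Otimes>\<^sub>M borel)"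
    by measurable
  then show ?thesis unfolding borel_prod by simp
qed

text \<open>Lusin's theorem, obtained by applying capacitability to the graph of
  \<open>\<psi>\<close> over \<open>D\<close>.\<close>

lemma Lusin_compact:
  fixes M :: "'a::polish_space measure" and \<psi> :: "'a \<Rightarrow> 'y::{complete_space,second_countable_topology}"
  assumes fin: "emeasure M (space M) \<noteq> \<infinity>" and sb: "sets M = sets borel"
    and D: "D \<in> sets borel" and \<psi>: "\<psi> \<in> borel_measurable borel" and r: "r < emeasure M D"
  shows "\<exists>K. compact K \<and> K \<subseteq> D \<and> continuous_on K \<psi> \<and> r \<le> emeasure M K"
proof -
  define R where "R = {p. fst p \<in> D \<and> snd p = \<psi> (fst p)}"
  have "fst ` R = D" unfolding R_def by (auto intro!: image_eqI[where x="(_, \<psi> _)"])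
  moreover have "R \<in> sets borel" unfolding R_def by (rule borel_graph_of_function[OF \<psi> D])
  ultimately obtain K where K: "compact K" "K \<subseteq> R" "r \<le> emeasure M (fst ` K)"
    using borel_fst_capacitable[OF fin sb, of R r] r D by (auto simp: sb)
  have "continuous_on (fst ` K) \<psi>"
    using K(1,2) by (intro compact_graph_continuous_on) (auto simp: R_def)
  moreover have "compact (fst ` K)"
    using K(1) by (intro compact_continuous_image continuous_intros)
  ultimately show ?thesis using K(2,3) by (intro exI[of _ "fst ` K"]) (auto simp: R_def)
qed

section \<open>Invariance along compact and Borel graphs of injections\<close>

locale pmp_borel_graph =
  fixes M :: "'a::polish_space measure" and E :: "'a \<Rightarrow> 'a \<Rightarrow> bool"
  assumes standard: "standard_prob_space M"
    and borel_graph: "borel_graph E"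
    and pmp: "pmp_graph M E"
begin

sublocale prob_space M
  using standard unfolding standard_prob_space_def by blast

lemma sets_M [measurable_cong, simp]: "sets M = sets borel"
  using standard unfolding standard_prob_space_def by blast

lemma space_M [simp]: "space M = UNIV"
  using sets_eq_imp_space_eq[OF sets_M] by simp

lemma E_sym: "E x y \<Longrightarrow> E y x"
  and E_irrefl: "\<not> E x x"
  and E_borel: "{(x, y). E x y} \<in> sets borel"
  using borel_graph unfolding borel_graph_def by blast+

lemma measurable_restrict_M:
  "f \<in> borel_measurable (restrict_space borel D) \<longleftrightarrow> f \<in> measurable (restrict_space M D) M"
  by (intro arg_cong2[where f="(\<in>)"] measurable_cong_sets refl sets_restrict_space_cong) auto

lemma pmp_preserves:
  assumes "D \<in> sets borel" "D' \<in> sets borel"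
    and f: "f \<in> borel_measurable (restrict_space borel D)" "f ` D = D'"
    and g: "g \<in> borel_measurable (restrict_space borel D')" "\<And>x. x \<in> D \<Longrightarrow> g (f x) = x"
    and "\<And>x. x \<in> D \<Longrightarrow> E\<^sup>*\<^sup>* x (f x)"
    and A: "A \<in> sets borel" "A \<subseteq> D"
  shows "emeasure M (f ` A) = emeasure M A"
proof -
  have inj: "inj_on f D" using g(2) by (metis inj_onI)
  have "the_inv_into D f y = g y" if "y \<in> D'" for y
    using that f(2) g(2) inj by (auto simp: the_inv_into_f_f)
  then have "the_inv_into D f \<in> borel_measurable (restrict_space borel D')"
    using g(1) by (subst measurable_cong[where g=g]) (auto simp: space_restrict_space)
  then have "partial_borel_bijection M D f"
    using assms inj unfolding partial_borel_bijection_def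
    by (auto simp: measurable_restrict_M[symmetric])
  then show ?thesis using pmp assms unfolding pmp_graph_def by auto
qed

text \<open>Compactness of \<open>G\<close> supplies every Borel requirement of a partial Borel
  bijection: both projections are compact and the maps in both directions are continuous.\<close>

lemma compact_bijection_preserves:
  assumes G: "compact G" and E: "\<And>x y. (x, y) \<in> G \<Longrightarrow> E\<^sup>*\<^sup>* x y"
    and f: "\<And>x y y'. (x, y) \<in> G \<Longrightarrow> (x, y') \<in> G \<Longrightarrow> y = y'"
    and g: "\<And>x x' y. (x, y) \<in> G \<Longrightarrow> (x', y) \<in> G \<Longrightarrow> x = x'"
  shows "emeasure M (fst ` G) = emeasure M (snd ` G)"
proof -
  define f where "f x = (THE y. (x, y) \<in> G)" for x
  define g where "g y = (THE x. (x, y) \<in> G)" for y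
  have f_eq: "y = f x" and g_eq: "x = g y" if "(x, y) \<in> G" for x y
    unfolding f_def g_def using assms(3,4) that by (auto intro!: the_equality[symmetric])
  have sw: "fst ` prod.swap ` G = snd ` G" by force
  have cpt: "compact (fst ` G)" "compact (snd ` G)" "compact (prod.swap ` G)"
    using G unfolding prod.swap_def
    by (auto intro!: compact_continuous_image continuous_intros simp del: image_eqI)
  have f: "continuous_on (fst ` G) f"
    using G f_eq by (rule compact_graph_continuous_on)
  have "continuous_on (fst ` prod.swap ` G) g"
    using cpt(3) g_eq by (intro compact_graph_continuous_on) auto
  then have g: "continuous_on (snd ` G) g" by (simp only: sw)
  have "f ` fst ` G = snd ` G" using f_eq by force
  moreover have "emeasure M (f ` fst ` G) = emeasure M (fst ` G)"
  proof (rule pmp_preserves[where D="fst ` G" and D'="snd ` G" and g=g])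
    show "E\<^sup>*\<^sup>* x (f x)" "g (f x) = x" if "x \<in> fst ` G" for x
      using that f_eq g_eq E by force+
  qed (use cpt f g f_eq in \<open>auto simp: compact_imp_closed borel_measurable_continuous_on_restrict
         intro!: rev_image_eqI\<close>)
  ultimately show ?thesis by simp
qed

text \<open>The projections of \<open>G\<close> are not known to be Borel, so outer measures are
  compared. Compact subsets of \<open>G\<close> exhaust the first projection, and for each of them
  the two projections have equal measure.\<close>

lemma borel_bijection_outer_measure_le:
  assumes G: "G \<in> sets borel" and E: "\<And>x y. (x, y) \<in> G \<Longrightarrow> E\<^sup>*\<^sup>* x y"
    and f: "\<And>x y y'. (x, y) \<in> G \<Longrightarrow> (x, y') \<in> G \<Longrightarrow> y = y'"
    and g: "\<And>x x' y. (x, y) \<in> G \<Longrightarrow> (x', y) \<in> G \<Longrightarrow> x = x'"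
  shows "outer_measure_of M (fst ` G) \<le> outer_measure_of M (snd ` G)"
proof (rule dense_le)
  fix r assume "r < outer_measure_of M (fst ` G)"
  then obtain K where K: "compact K" "K \<subseteq> G" "r \<le> emeasure M (fst ` K)"
    using borel_fst_capacitable[OF _ sets_M G] by (auto simp: emeasure_eq_measure)
  have "compact (snd ` K)"
    using K(1) by (intro compact_continuous_image continuous_intros)
  have "r \<le> emeasure M (snd ` K)"
    using compact_bijection_preserves[OF K(1)] K E f g by (metis subsetD)
  also have "\<dots> = outer_measure_of M (snd ` K)"
    using \<open>compact (snd ` K)\<close> by (intro outer_measure_of_eq[symmetric]) (simp add: compact_imp_closed)
  also have "\<dots> \<le> outer_measure_of M (snd ` G)"
    using K(2) by (intro outer_measure_of_mono image_mono)
  finally show "r \<le> outer_measure_of M (snd ` G)" .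
qed

end


section \<open>Branches of perfect trees\<close>

definition perfect_tree :: "bool list set \<Rightarrow> bool" where
  "perfect_tree T \<longleftrightarrow> [] \<in> T \<and> (\<forall>s b. s @ [b] \<in> T \<longrightarrow> s \<in> T) \<and>
     (\<forall>s\<in>T. \<exists>u. s @ u @ [True] \<in> T \<and> s @ u @ [False] \<in> T)"

text \<open>The branch of \<open>T\<close> that reads one bit of \<open>b\<close> at every splitting node; the second component
  counts the bits read so far.\<close>

fun branch :: "bool list set \<Rightarrow> (nat \<Rightarrow> bool) \<Rightarrow> nat \<Rightarrow> bool list \<times> nat" where
  "branch T b 0 = ([], 0)"
| "branch T b (Suc n) = (case branch T b n of (s, k) \<Rightarrow>
     if s @ [True] \<in> T \<and> s @ [False] \<in> T then (s @ [b k], Suc k) else (s @ [s @ [True] \<in> T], k))"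

lemma perfect_tree_prefix:
  assumes "perfect_tree T" "s @ u \<in> T"
  shows "s \<in> T"
  using assms(2)
proof (induction u rule: rev_induct)
  case (snoc b u)
  then have "(s @ u) @ [b] \<in> T" by simp
  then have "s @ u \<in> T" using assms(1) unfolding perfect_tree_def by blast
  then show ?case by (rule snoc.IH)
qed simp

lemma perfect_tree_child:
  assumes "perfect_tree T" "s \<in> T"
  shows "s @ [True] \<in> T \<or> s @ [False] \<in> T"
proof -
  obtain u where u: "s @ u @ [True] \<in> T" "s @ u @ [False] \<in> T"
    using assms unfolding perfect_tree_def by blast
  show ?thesis
  proof (cases u)
    case Nil
    then show ?thesis using u by simp
  next
    case (Cons b u')
    then have "(s @ [b]) @ (u' @ [True]) \<in> T" using u by simp
    then have "s @ [b] \<in> T" by (rule perfect_tree_prefix[OF assms(1)])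
    then show ?thesis by (cases b) auto
  qed
qed

lemma length_branch: "length (fst (branch T b n)) = n"
  by (induction n) (auto split: prod.splits)

lemma take_branch: "m \<le> n \<Longrightarrow> take m (fst (branch T b n)) = fst (branch T b m)"
proof (induction n)
  case (Suc n)
  have "\<exists>v. fst (branch T b (Suc n)) = fst (branch T b n) @ [v]"
    by (auto split: prod.splits)
  then obtain v where "fst (branch T b (Suc n)) = fst (branch T b n) @ [v]" ..
  then show ?case
    using Suc length_branch[of T b n] length_branch[of T b "Suc n"]
    by (cases "m = Suc n") auto
qed simp

lemma branch_in:
  assumes "perfect_tree T"
  shows "fst (branch T b n) \<in> T"
proof (induction n)
  case 0
  then show ?case using assms by (simp add: perfect_tree_def)
next
  case (Suc n)
  then show ?case using perfect_tree_child[OF assms Suc]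
    by (cases "b (snd (branch T b n))") (auto split: prod.splits)
qed

text \<open>If no node split from step \<open>n\<close> on, every later step would be forced. The
  branch would then follow any extension of its node inside \<open>T\<close>, in particular one that
  leads to a splitting node.\<close>

lemma branch_splits_later:
  assumes T: "perfect_tree T"
  shows "\<exists>m\<ge>n. fst (branch T b m) @ [True] \<in> T \<and> fst (branch T b m) @ [False] \<in> T"
proof (rule ccontr)
  define s where "s = fst (branch T b n)"
  assume no: "\<not> ?thesis"
  have follow: "fst (branch T b (n + length u)) = s @ u" if "s @ u \<in> T" for u
    using that
  proof (induction u rule: rev_induct)
    case (snoc v u)
    then have "s @ u \<in> T" using perfect_tree_prefix[OF T, of "s @ u" "[v]"] by simp
    with snoc have eq: "fst (branch T b (n + length u)) = s @ u" by blast
    have "\<not> (s @ u @ [True] \<in> T \<and> s @ u @ [False] \<in> T)"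
      using no eq by (metis append.assoc le_add1)
    then show ?case using eq snoc.prems by (cases v) (auto split: prod.splits)
  qed (simp add: s_def)
  have "s \<in> T" unfolding s_def by (rule branch_in[OF T])
  then obtain u where u: "s @ u @ [True] \<in> T" "s @ u @ [False] \<in> T"
    using T unfolding perfect_tree_def by blast
  then have "s @ u \<in> T" using perfect_tree_prefix[OF T, of "s @ u" "[True]"] by simp
  with u follow[of u] no show False by (metis append.assoc le_add1)
qed

text \<open>The number of bits read depends only on the nodes visited, so both branches read bit
  \<open>k\<close> at the same splitting node, and the child chosen there reveals it. Every bit is
  read because splitting nodes recur.\<close>

lemma branch_inject:
  assumes T: "perfect_tree T" and eq: "\<And>n. fst (branch T b n) = fst (branch T b' n)"
  shows "b = b'"
proof
  fix k
  have snd_eq: "snd (branch T b n) = snd (branch T b' n)" for n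
  proof (induction n)
    case (Suc n)
    then show ?case using eq[of n] by (auto split: prod.splits)
  qed simp
  have "\<exists>n. snd (branch T b n) = k"
  proof (induction k)
    case 0
    then show ?case by (intro exI[of _ 0]) simp
  next
    case (Suc k)
    then obtain n where n: "snd (branch T b n) = k" ..
    define split where
      "split m \<longleftrightarrow> fst (branch T b m) @ [True] \<in> T \<and> fst (branch T b m) @ [False] \<in> T" for m
    obtain d where "split (n + d)"
      using branch_splits_later[OF T, of n b] unfolding split_def by (metis le_iff_add)
    then have "\<exists>d. split (n + d)" ..
    \<comment> \<open>The next splitting node. No bit is read on the way to it, so the counter
      passes from \<open>k\<close> to \<open>Suc k\<close> exactly there.\<close>
    define d where "d = (LEAST d. split (n + d))"
    have d: "split (n + d)" "\<And>e. e < d \<Longrightarrow> \<not> split (n + e)"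
      unfolding d_def using \<open>\<exists>d. split (n + d)\<close> by (auto intro: LeastI_ex dest: not_less_Least)
    have "e \<le> d \<Longrightarrow> snd (branch T b (n + e)) = k" for e
    proof (induction e)
      case (Suc e)
      then show ?case using d(2)[of e] by (auto simp: split_def split: prod.splits)
    qed (simp add: n)
    from this[of d] have "snd (branch T b (Suc (n + d))) = Suc k"
      using d(1) by (auto simp: split_def split: prod.splits)
    then show ?case ..
  qed
  then obtain n where n: "snd (branch T b n) = k" ..
  show "b k = b' k"
  proof -
    obtain d where "fst (branch T b (n + d)) @ [True] \<in> T \<and> fst (branch T b (n + d)) @ [False] \<in> T"
      using branch_splits_later[OF T, of n b] by (metis le_iff_add)
    then show ?thesis
      using n
    proof (induction d arbitrary: n)
      case 0
      then show ?case using eq[of n] eq[of "Suc n"] snd_eq[of n] by (auto split: prod.splits)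
    next
      case (Suc d)
      show ?case
      proof (cases "fst (branch T b n) @ [True] \<in> T \<and> fst (branch T b n) @ [False] \<in> T")
        case True
        then show ?thesis
          using Suc.prems(2) eq[of n] eq[of "Suc n"] snd_eq[of n] by (auto split: prod.splits)
      next
        case False
        then have "snd (branch T b (Suc n)) = k"
          using Suc.prems(2) by (auto split: prod.splits)
        then show ?thesis using Suc.IH[of "Suc n"] Suc.prems(1) by simp
      qed
    qed
  qed
qed

text \<open>The bits "\<open>x\<close> lies in \<open>B i\<close>" form the binary code of
  \<open>x\<close>; a cylinder fixes an initial segment of the code.\<close>

definition cylinder :: "(nat \<Rightarrow> 'a set) \<Rightarrow> bool list \<Rightarrow> 'a set" where
  "cylinder B s = {x. \<forall>i<length s. (x \<in> B i) = s ! i}"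

lemma cylinder_borel: "(\<And>n. B n \<in> sets M) \<Longrightarrow> space M = UNIV \<Longrightarrow> cylinder B s \<in> sets M"
proof -
  assume [measurable]: "\<And>n. B n \<in> sets M" and sp: "space M = UNIV"
  have "{x \<in> space M. \<forall>i<length s. (x \<in> B i) = s ! i} \<in> sets M" by measurable
  then show ?thesis by (simp add: cylinder_def sp)
qed

lemma cylinder_snoc: "cylinder B (s @ [b]) = cylinder B s \<inter> {x. (x \<in> B (length s)) = b}"
  unfolding cylinder_def by (auto simp: nth_append less_Suc_eq)

lemma cylinder_take: "cylinder B s \<subseteq> cylinder B (take n s)"
  unfolding cylinder_def by auto

text \<open>Radon-Nikodym: \<open>N1\<close> has a density with respect to \<open>N2\<close>, and
  \<open>P\<close> is the set where it does not vanish.\<close>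

lemma positivity_set:
  assumes "finite_measure N2" "sets N1 = sets N2" "\<And>A. A \<in> sets N2 \<Longrightarrow> emeasure N1 A \<le> emeasure N2 A"
  shows "\<exists>P\<in>sets N2. emeasure N1 (space N2 - P) = 0 \<and>
    (\<forall>Z\<in>sets N2. Z \<subseteq> P \<longrightarrow> emeasure N1 Z = 0 \<longrightarrow> emeasure N2 Z = 0)"
proof -
  interpret N2: finite_measure N2 by fact
  have ac: "absolutely_continuous N2 N1"
    unfolding absolutely_continuous_def
  proof
    fix A assume "A \<in> null_sets N2"
    then show "A \<in> null_sets N1" using assms(2) assms(3)[of A] by (auto simp: null_sets_def)
  qed
  define f where "f = RN_deriv N2 N1"
  have N1: "density N2 f = N1" unfolding f_def by (rule N2.density_RN_deriv[OF ac assms(2)])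
  have f [measurable]: "f \<in> borel_measurable N2" unfolding f_def by simp
  define P where "P = {x \<in> space N2. f x \<noteq> 0}"
  have P [measurable]: "P \<in> sets N2" unfolding P_def by measurable
  have "emeasure N1 (space N2 - P) = (\<integral>\<^sup>+x. f x * indicator (space N2 - P) x \<partial>N2)"
    unfolding N1[symmetric] by (rule emeasure_density) auto
  also have "\<dots> = (\<integral>\<^sup>+x. 0 \<partial>N2)"
    by (intro nn_integral_cong) (auto simp: P_def indicator_def)
  finally have "emeasure N1 (space N2 - P) = 0" by simp
  moreover have "emeasure N2 Z = 0" if Z: "Z \<in> sets N2" "Z \<subseteq> P" "emeasure N1 Z = 0" for Z
  proof -
    have "(\<integral>\<^sup>+x. f x * indicator Z x \<partial>N2) = 0"
      using Z(3) emeasure_density[OF f Z(1)] unfolding N1 by simp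
    then have "AE x in N2. f x * indicator Z x = 0"
      using Z(1) by (subst (asm) nn_integral_0_iff_AE) auto
    then have "AE x in N2. x \<notin> Z"
      by eventually_elim (use Z(2) in \<open>auto simp: P_def indicator_def split: if_splits\<close>)
    then show ?thesis using Z(1) by (simp add: AE_iff_null_sets null_setsD1)
  qed
  ultimately show ?thesis using P by blast
qed

section \<open>Mass on the fibres of a Borel function\<close>

context pmp_borel_graph begin

text \<open>Push the restrictions of \<open>M\<close> to \<open>S\<close> and to \<open>K\<close>
  forward under \<open>\<phi>\<close> and compare them. Up to null sets, \<open>P\<close> consists
  of the values whose fibre in \<open>K\<close> gives positive conditional mass to \<open>S\<close>;
  no disintegration has to be constructed.\<close>

lemma fibre_support:
  assumes [measurable]: "S \<in> sets borel" "K \<in> sets borel" "\<phi> \<in> borel_measurable borel" and SK: "S \<subseteq> K"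
  shows "\<exists>P\<in>sets (borel :: 'a measure). emeasure M (S \<inter> \<phi> -` (- P)) = 0 \<and>
    (\<forall>Z\<in>sets borel. Z \<subseteq> P \<longrightarrow> emeasure M (S \<inter> \<phi> -` Z) = 0 \<longrightarrow> emeasure M (K \<inter> \<phi> -` Z) = 0)"
proof -
  define \<nu> where "\<nu> S = distr (density M (indicator S)) borel \<phi>" for S
  have \<nu>: "emeasure (\<nu> S) A = emeasure M (S \<inter> \<phi> -` A)"
    if [measurable]: "S \<in> sets borel" "A \<in> sets borel" for S A
  proof -
    have "emeasure (\<nu> S) A = (\<integral>\<^sup>+x. indicator S x * indicator (\<phi> -` A) x \<partial>M)"
      unfolding \<nu>_def using measurable_sets_borel[OF assms(3) that(2)]
      by (subst emeasure_distr) (auto simp: emeasure_density)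
    also have "\<dots> = (\<integral>\<^sup>+x. indicator (S \<inter> \<phi> -` A) x \<partial>M)"
      by (intro nn_integral_cong) (auto simp: indicator_def)
    finally show ?thesis using measurable_sets_borel[OF assms(3) that(2)] by simp
  qed
  have sets_\<nu>: "sets (\<nu> S) = sets borel" "space (\<nu> S) = UNIV" for S
    by (auto simp: \<nu>_def)
  have "finite_measure (\<nu> K)"
    by (rule finite_measureI) (auto simp: sets_\<nu> \<nu> emeasure_eq_measure)
  moreover have "emeasure (\<nu> S) A \<le> emeasure (\<nu> K) A" if "A \<in> sets (\<nu> K)" for A
    using SK that measurable_sets_borel[OF assms(3)] by (auto simp: sets_\<nu> \<nu> intro!: emeasure_mono)
  ultimately obtain P where P: "P \<in> sets borel" "emeasure (\<nu> S) (UNIV - P) = 0"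
    "\<forall>Z\<in>sets borel. Z \<subseteq> P \<longrightarrow> emeasure (\<nu> S) Z = 0 \<longrightarrow> emeasure (\<nu> K) Z = 0"
    using positivity_set[of "\<nu> K" "\<nu> S"] by (auto simp: sets_\<nu>)
  then show ?thesis
    by (intro bexI[of _ P]) (simp_all add: \<nu> Compl_eq_Diff_UNIV)
qed

text \<open>An injection along edges cannot increase outer measure when read backwards from its
  image, and the image lies inside the null set \<open>N\<close>.\<close>

lemma section_null:
  assumes "S \<in> sets borel" "\<phi> \<in> borel_measurable borel" "inj_on \<phi> S"
    and "N \<in> null_sets M" "\<And>x. x \<in> S \<Longrightarrow> \<phi> x \<in> N \<and> E x (\<phi> x)"
  shows "emeasure M S = 0"
proof -
  define G where "G = {p. fst p \<in> S \<and> snd p = \<phi> (fst p)}"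
  have fG: "fst ` G = S" unfolding G_def by (auto intro!: image_eqI[where x="(_, \<phi> _)"])
  have sG: "snd ` G \<subseteq> N" unfolding G_def using assms(5) by auto
  have "outer_measure_of M (fst ` G) \<le> outer_measure_of M (snd ` G)"
  proof (rule borel_bijection_outer_measure_le)
    show "G \<in> sets borel" unfolding G_def by (rule borel_graph_of_function[OF assms(2,1)])
  qed (use assms in \<open>auto simp: G_def inj_on_def\<close>)
  also have "\<dots> \<le> outer_measure_of M N" using sG by (rule outer_measure_of_mono)
  also have "\<dots> = 0" using assms(4) by (subst outer_measure_of_eq) auto
  finally show ?thesis using assms(1) fG by simp
qed

end


section \<open>Neighbours in null sets\<close>

lemma separating_open_sequence:
  obtains B :: "nat \<Rightarrow> 'a::{t1_space,second_countable_topology} set"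
  where "\<And>n. open (B n)" "\<And>U x. open U \<Longrightarrow> x \<in> U \<Longrightarrow> \<exists>n. x \<in> B n \<and> B n \<subseteq> U"
proof -
  obtain \<B> :: "'a set set" where \<B>: "countable \<B>" "topological_basis \<B>"
    using ex_countable_basis by blast
  have ne: "\<B> \<noteq> {}" using topological_basisE[OF \<B>(2) open_UNIV UNIV_I] by blast
  show thesis
  proof (rule that[of "from_nat_into \<B>"])
    show "open (from_nat_into \<B> n)" for n
      using \<B>(2) ne by (simp add: from_nat_into topological_basis_open)
    show "\<exists>n. x \<in> from_nat_into \<B> n \<and> from_nat_into \<B> n \<subseteq> U" if "open U" "x \<in> U" for U x
      using topological_basisE[OF \<B>(2) that] from_nat_into_surj[OF \<B>(1)] by metis
  qed
qed

context pmp_borel_graph begin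

text \<open>A fibre of \<open>\<phi>\<close> lies in one component. If \<open>D\<close> had positive measure, almost all fibres would contain a
  perfect set, since Borel sets on which \<open>\<phi>\<close> is injective are null. Each point can then be moved along
  its fibre to the point of that perfect set coded by its own binary code. Prefixing the code with one
  bit gives two such injections with disjoint images, which doubles the measure.\<close>

lemma null_target:
  assumes D: "D \<in> sets borel" and \<phi> [measurable]: "\<phi> \<in> borel_measurable borel" and N: "N \<in> null_sets M"
    and DN: "\<And>x. x \<in> D \<Longrightarrow> \<phi> x \<in> N \<and> E x (\<phi> x)"
  shows "emeasure M D = 0"
proof (rule ccontr)
  assume "emeasure M D \<noteq> 0"
  then obtain r where r: "0 < r" "r < emeasure M D"
    using dense[of 0 "emeasure M D"] by (auto simp: zero_less_iff_neq_zero)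
  obtain B :: "nat \<Rightarrow> 'a set" where B_open: "\<And>n. open (B n)"
    and B_base: "\<And>U x. open U \<Longrightarrow> x \<in> U \<Longrightarrow> \<exists>n. x \<in> B n \<and> B n \<subseteq> U"
    using separating_open_sequence by blast
  have B [measurable]: "B n \<in> sets borel" for n using B_open by simp
  have B_sep: "x = y" if "\<And>n. x \<in> B n \<longleftrightarrow> y \<in> B n" for x y
    using B_base[of "- {y}" x] that by auto
  let ?cyl = "cylinder B"
  have cyl [measurable]: "?cyl s \<in> sets borel" for s by (rule cylinder_borel) auto
  \<comment> \<open>Lusin's theorem is applied to \<open>\<phi>\<close> and all indicators at once.
    On \<open>K\<close> the sets \<open>B n\<close> become relatively clopen, so every cylinder
    meets \<open>K\<close> in a compact set.\<close>
  define \<psi> where "\<psi> x = (\<phi> x, \<lambda>n. indicator (B n) x :: real)" for x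
  have "\<psi> \<in> borel_measurable borel"
    unfolding \<psi>_def
    by (intro borel_measurable_Pair \<phi> measurable_coordinatewise_then_product) measurable
  then obtain K where K: "compact K" "K \<subseteq> D" "continuous_on K \<psi>" "r \<le> emeasure M K"
    using Lusin_compact[OF _ sets_M D _ r(2), of \<psi>] by (auto simp: emeasure_eq_measure)
  have K_pos: "emeasure M K > 0" using K(4) r(1) by order
  have K_borel [measurable]: "K \<in> sets borel" using K(1) by (simp add: compact_imp_closed)
  have cont_\<phi>: "continuous_on K \<phi>"
    using continuous_on_fst[OF K(3)] by (simp add: \<psi>_def)
  have cont_B: "continuous_on K (\<lambda>x. indicator (B n) x :: real)" for n
    using continuous_on_product_then_coordinatewise[OF continuous_on_snd[OF K(3)], of n]
    by (simp add: \<psi>_def)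
  have K_cyl: "compact (K \<inter> ?cyl s)" for s
  proof -
    have "K \<inter> ?cyl s = K \<inter> (\<Inter>i\<in>{..<length s}. {x \<in> K. (indicator (B i) x :: real) = of_bool (s ! i)})"
      by (auto simp: cylinder_def indicator_def split: if_splits)
    moreover have "closed {x \<in> K. (indicator (B i) x :: real) = of_bool (s ! i)}" for i
      using cont_B K(1) by (intro continuous_closed_preimage_constant) (auto simp: compact_imp_closed)
    ultimately show ?thesis using K(1) by (auto intro!: compact_Int_closed closed_INT)
  qed

  \<comment> \<open>\<open>P s\<close> collects the values whose fibre carries mass in the cylinder
    of \<open>s\<close>. For a fixed value, the strings \<open>s\<close> of this kind will form the
    tree \<open>T\<close>.\<close>
  have pos: "\<exists>P. P \<in> sets (borel :: 'a measure) \<and> emeasure M (K \<inter> ?cyl s \<inter> \<phi> -` (- P)) = 0 \<and>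
      (\<forall>Z\<in>sets borel. Z \<subseteq> P \<longrightarrow> emeasure M (K \<inter> ?cyl s \<inter> \<phi> -` Z) = 0 \<longrightarrow> emeasure M (K \<inter> \<phi> -` Z) = 0)" for s
    using fibre_support[of "K \<inter> ?cyl s" K \<phi>] by (auto simp: Bex_def)
  obtain P :: "bool list \<Rightarrow> 'a set" where P [measurable]: "\<And>s. P s \<in> sets borel"
    and P0: "\<And>s. emeasure M (K \<inter> ?cyl s \<inter> \<phi> -` (- P s)) = 0"
    and P1: "\<And>s Z. Z \<in> sets borel \<Longrightarrow> Z \<subseteq> P s \<Longrightarrow> emeasure M (K \<inter> ?cyl s \<inter> \<phi> -` Z) = 0 \<Longrightarrow>
        emeasure M (K \<inter> \<phi> -` Z) = 0"
    using pos by metis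
  have vim [measurable]: "Z \<in> sets borel \<Longrightarrow> \<phi> -` Z \<in> sets borel" for Z
    using measurable_sets_borel[OF \<phi>] by simp
  define T where "T z = {s. z \<in> P s}" for z

  have bad_root: "emeasure M (K \<inter> \<phi> -` (- P [])) = 0"
    using P0[of "[]"] by (simp add: cylinder_def)
  \<comment> \<open>This exceptional set of values and the next ones lie inside some
    \<open>P t\<close>. By \<open>P1\<close> it is enough that they carry no mass in the one
    cylinder of \<open>t\<close>.\<close>
  have bad_prefix: "emeasure M (K \<inter> \<phi> -` (P (s @ [b]) - P s)) = 0" for s b
  proof (rule P1[of _ "s @ [b]"])
    have "emeasure M (K \<inter> ?cyl (s @ [b]) \<inter> \<phi> -` (P (s @ [b]) - P s)) \<le>
        emeasure M (K \<inter> ?cyl s \<inter> \<phi> -` (- P s))"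
      by (intro emeasure_mono) (auto simp: cylinder_snoc)
    then show "emeasure M (K \<inter> ?cyl (s @ [b]) \<inter> \<phi> -` (P (s @ [b]) - P s)) = 0"
      using P0[of s] by simp
  qed auto
  have img [measurable]: "\<phi> ` (K \<inter> ?cyl s) \<in> sets borel" for s
    using compact_continuous_image[OF continuous_on_subset[OF cont_\<phi>] K_cyl[of s]]
    by (simp add: compact_imp_closed)
  have bad_empty: "emeasure M (K \<inter> \<phi> -` (P s - \<phi> ` (K \<inter> ?cyl s))) = 0" for s
  proof (rule P1[of _ s])
    have "K \<inter> ?cyl s \<inter> \<phi> -` (P s - \<phi> ` (K \<inter> ?cyl s)) = {}" by auto
    then show "emeasure M (K \<inter> ?cyl s \<inter> \<phi> -` (P s - \<phi> ` (K \<inter> ?cyl s))) = 0" by simp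
  qed auto
  define Q where "Q s = P s - (\<Union>u. P (s @ u @ [True]) \<inter> P (s @ u @ [False]))" for s
  have Q [measurable]: "Q s \<in> sets borel" for s unfolding Q_def by measurable
  have bad_thin: "emeasure M (K \<inter> \<phi> -` Q s) = 0" for s
  proof (rule P1[of _ s])
    \<comment> \<open>If two points of \<open>S\<close> share a value and first differ at place
      \<open>n\<close>, their common code up to \<open>n\<close> extends \<open>s\<close>. Both
      children of that code carry mass on the fibre, which \<open>Q s\<close> excludes. So
      \<open>\<phi>\<close> is injective on \<open>S\<close>, and \<open>section_null\<close>
      applies.\<close>
    define S where "S = (K \<inter> ?cyl s \<inter> \<phi> -` Q s) - (\<Union>t. K \<inter> ?cyl t \<inter> \<phi> -` (- P t))"
    have S [measurable]: "S \<in> sets borel" unfolding S_def by measurable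
    have "x = y" if x: "x \<in> S" and y: "y \<in> S" and xy: "\<phi> x = \<phi> y" for x y
    proof (rule ccontr)
      assume "x \<noteq> y"
      then have diff: "\<exists>n. (x \<in> B n) \<noteq> (y \<in> B n)" using B_sep by blast
      then obtain n where n: "(x \<in> B n) \<noteq> (y \<in> B n)" "\<And>m. m < n \<Longrightarrow> (x \<in> B m) = (y \<in> B m)"
        using exists_least_iff[of "\<lambda>n. (x \<in> B n) \<noteq> (y \<in> B n)"] by blast
      define t where "t = map (\<lambda>m. x \<in> B m) [0..<n]"
      have xt: "x \<in> ?cyl t" "y \<in> ?cyl t" using n(2) by (auto simp: t_def cylinder_def)
      have "length s \<le> n"
      proof (rule ccontr)
        assume "\<not> length s \<le> n"
        then have "(x \<in> B n) = s ! n" "(y \<in> B n) = s ! n"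
          using x y by (auto simp: S_def cylinder_def)
        then show False using n(1) by blast
      qed
      have "take (length s) t = s"
        using x \<open>length s \<le> n\<close> by (intro nth_equalityI) (auto simp: t_def S_def cylinder_def)
      then obtain u where u: "t = s @ u" by (metis append_take_drop_id)
      have "x \<in> ?cyl (t @ [x \<in> B n])" "y \<in> ?cyl (t @ [y \<in> B n])"
        using xt by (auto simp: cylinder_snoc t_def)
      then have "\<phi> x \<in> P (t @ [x \<in> B n])" "\<phi> x \<in> P (t @ [y \<in> B n])"
        using x y xy by (auto simp: S_def)
      then have "\<phi> x \<in> P (s @ u @ [True]) \<inter> P (s @ u @ [False])"
        using n(1) u by (cases "x \<in> B n"; cases "y \<in> B n") auto
      then show False using x by (auto simp: S_def Q_def)
    qed
    then have "inj_on \<phi> S" by (auto intro: inj_onI)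
    then have "emeasure M S = 0"
      using S K(2) DN by (intro section_null[OF _ \<phi> _ N]) (auto simp: S_def)
    then have "S \<in> null_sets M" by auto
    moreover have "(\<Union>t. K \<inter> ?cyl t \<inter> \<phi> -` (- P t)) \<in> null_sets M"
      using P0 by (intro null_sets_UN) (auto simp: null_sets_def)
    ultimately have "S \<union> (\<Union>t. K \<inter> ?cyl t \<inter> \<phi> -` (- P t)) \<in> null_sets M"
      by (rule null_sets.Un)
    then show "emeasure M (K \<inter> ?cyl s \<inter> \<phi> -` Q s) = 0"
      by (intro null_setsD1[OF null_sets_subset[rotated 2]]) (auto simp: S_def)
  qed (auto simp: Q_def)

  define Z where "Z = - P [] \<union> (\<Union>s. \<Union>b. P (s @ [b]) - P s) \<union> (\<Union>s. P s - \<phi> ` (K \<inter> ?cyl s)) \<union> (\<Union>s. Q s)"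
  have Z [measurable]: "Z \<in> sets borel" unfolding Z_def by measurable
  have "K \<inter> \<phi> -` (- P []) \<in> null_sets M" "(\<Union>s. \<Union>b. K \<inter> \<phi> -` (P (s @ [b]) - P s)) \<in> null_sets M"
    "(\<Union>s. K \<inter> \<phi> -` (P s - \<phi> ` (K \<inter> ?cyl s))) \<in> null_sets M" "(\<Union>s. K \<inter> \<phi> -` Q s) \<in> null_sets M"
    by ((intro null_sets_UN null_setsI bad_root bad_prefix bad_empty bad_thin; measurable)+)
  then have "(K \<inter> \<phi> -` (- P [])) \<union> (\<Union>s. \<Union>b. K \<inter> \<phi> -` (P (s @ [b]) - P s)) \<union>
      (\<Union>s. K \<inter> \<phi> -` (P s - \<phi> ` (K \<inter> ?cyl s))) \<union> (\<Union>s. K \<inter> \<phi> -` Q s) \<in> null_sets M"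
    (is "?W \<in> _")
    by (intro null_sets.Un)
  moreover have "?W = K \<inter> \<phi> -` Z" unfolding Z_def by blast
  ultimately have KZ: "K \<inter> \<phi> -` Z \<in> null_sets M" by simp
  define K1 where "K1 = K - K \<inter> \<phi> -` Z"
  have K1 [measurable]: "K1 \<in> sets borel" unfolding K1_def by measurable
  have K1_eq: "emeasure M K1 = emeasure M K"
    unfolding K1_def using KZ by (intro emeasure_Diff_null_set) auto
  have perf: "perfect_tree (T (\<phi> x))" if "x \<in> K1" for x
    using that unfolding K1_def Z_def perfect_tree_def T_def Q_def by auto
  have fib: "\<exists>y\<in>K \<inter> ?cyl s. \<phi> y = \<phi> x" if "x \<in> K1" "s \<in> T (\<phi> x)" for x s
  proof -
    have "\<phi> x \<in> \<phi> ` (K \<inter> ?cyl s)" using that unfolding K1_def Z_def T_def by auto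
    then show ?thesis by auto
  qed

  define br where "br b x n = branch (T (\<phi> x)) (case_nat b (\<lambda>m. x \<in> B m)) n" for b :: bool and x n
  \<comment> \<open>The state reached after \<open>n\<close> steps has countably many possible
    values, and the next state depends on Borel conditions and one bit of the code.\<close>
  have br: "{x. br b x n = v} \<in> sets borel" for b n v
  proof (induction n arbitrary: v)
    case 0
    then show ?case by (cases "v = ([], 0)") (auto simp: br_def)
  next
    case (Suc n)
    have step: "br b x (Suc n) = v \<longleftrightarrow> (\<exists>w. br b x n = w \<and>
       (if \<phi> x \<in> P (fst w @ [True]) \<and> \<phi> x \<in> P (fst w @ [False])
        then v = (fst w @ [case snd w of 0 \<Rightarrow> b | Suc m \<Rightarrow> x \<in> B m], Suc (snd w))
        else v = (fst w @ [\<phi> x \<in> P (fst w @ [True])], snd w)))" for x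
      by (auto simp: br_def T_def split: prod.splits)
    have bit: "{x. (case k of 0 \<Rightarrow> b | Suc m \<Rightarrow> x \<in> B m) = c} \<in> sets borel" for k c
      by (cases k; cases c) (auto simp: Collect_neg_eq[symmetric])
    have "{x. br b x (Suc n) = v} = (\<Union>w. {x. br b x n = w} \<inter>
       ((\<phi> -` P (fst w @ [True]) \<inter> \<phi> -` P (fst w @ [False]) \<inter>
          (\<Union>c\<in>{c. v = (fst w @ [c], Suc (snd w))}. {x. (case snd w of 0 \<Rightarrow> b | Suc m \<Rightarrow> x \<in> B m) = c})) \<union>
        ((- (\<phi> -` P (fst w @ [True]) \<inter> \<phi> -` P (fst w @ [False]))) \<inter>
          ((\<phi> -` P (fst w @ [True]) \<inter> {x. v = (fst w @ [True], snd w)}) \<union>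
           (- (\<phi> -` P (fst w @ [True])) \<inter> {x. v = (fst w @ [False], snd w)})))))"
      by (intro set_eqI) (auto simp: step split: if_splits)
    also have "\<dots> \<in> sets borel"
      using Suc bit by (intro sets.countable_UN sets.Int sets.Un) auto
    finally show ?case by simp
  qed
  note [measurable] = br
  have br_fst [measurable]: "{x. fst (br b x n) = s} \<in> sets borel" for b n s
  proof -
    have "{x. fst (br b x n) = s} = (\<Union>k. {x. br b x n = (s, k)})"
      by (auto simp: prod_eq_iff)
    also have "\<dots> \<in> sets borel" by measurable
    finally show ?thesis .
  qed
  define G where "G b = {(x, y). x \<in> K1 \<and> y \<in> K \<and> \<phi> y = \<phi> x \<and> (\<forall>n. y \<in> ?cyl (fst (br b x n)))}" for b
  have G_borel: "G b \<in> sets borel" for b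
  proof -
    have "{p \<in> space (borel \<Otimes>\<^sub>M borel). fst p \<in> K1 \<and> snd p \<in> K \<and> dist (\<phi> (snd p)) (\<phi> (fst p)) = 0 \<and>
       (\<forall>n. \<exists>s. fst p \<in> {x. fst (br b x n) = s} \<and> snd p \<in> ?cyl s)} \<in> sets (borel \<Otimes>\<^sub>M borel)"
      by measurable
    also have "{p \<in> space (borel \<Otimes>\<^sub>M borel). fst p \<in> K1 \<and> snd p \<in> K \<and> dist (\<phi> (snd p)) (\<phi> (fst p)) = 0 \<and>
       (\<forall>n. \<exists>s. fst p \<in> {x. fst (br b x n) = s} \<and> snd p \<in> ?cyl s)} = G b"
      unfolding G_def by (auto simp: space_pair_measure)
    finally show ?thesis unfolding borel_prod .
  qed
  have fst_G: "fst ` G b = K1" for b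
  proof
    show "K1 \<subseteq> fst ` G b"
    proof
      fix x assume x: "x \<in> K1"
      \<comment> \<open>Nested compact pieces of the fibre. Each is nonempty because the nodes of
        the branch lie in the tree, so some point of the fibre follows the whole branch.\<close>
      define F where "F n = {y \<in> K. \<phi> y = \<phi> x} \<inter> (K \<inter> ?cyl (fst (br b x n)))" for n
      have "closed (F n)" for n
        unfolding F_def
        by (intro closed_Int continuous_closed_preimage_constant[OF cont_\<phi>] compact_imp_closed K_cyl K(1))
      moreover have "K \<inter> (\<Inter>n\<in>I. F n) \<noteq> {}" if I: "finite I" for I
      proof -
        obtain m where m: "\<And>n. n \<in> I \<Longrightarrow> n \<le> m"
          using I unfolding finite_nat_set_iff_bounded_le by blast
        have "fst (br b x m) \<in> T (\<phi> x)" unfolding br_def using perf[OF x] by (rule branch_in)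
        then obtain y where y: "y \<in> K" "y \<in> ?cyl (fst (br b x m))" "\<phi> y = \<phi> x" using fib[OF x] by blast
        have "y \<in> ?cyl (fst (br b x n))" if "n \<in> I" for n
        proof -
          have "take n (fst (br b x m)) = fst (br b x n)"
            unfolding br_def using m[OF that] by (rule take_branch)
          then show ?thesis using y(2) cylinder_take[of B "fst (br b x m)" n] by auto
        qed
        then have "y \<in> K \<inter> (\<Inter>n\<in>I. F n)" using y unfolding F_def by auto
        then show ?thesis by blast
      qed
      ultimately have "K \<inter> (\<Inter>n\<in>UNIV. F n) \<noteq> {}"
        using compact_imp_fip_image[OF K(1), of UNIV F] by blast
      then obtain y where "y \<in> K" "\<And>n. y \<in> F n" by blast
      then have "(x, y) \<in> G b" using x unfolding G_def F_def by auto
      then show "x \<in> fst ` G b" by force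
    qed
  qed (auto simp: G_def)
  have code: "(y \<in> B n) = fst (br b x (Suc n)) ! n" if "(x, y) \<in> G b" for x y b n
    using that length_branch[of _ _ "Suc n"] unfolding G_def br_def cylinder_def
    by (metis (mono_tags, lifting) case_prodD lessI mem_Collect_eq)
  have br_eq: "fst (br b x n) = map (\<lambda>m. y \<in> B m) [0..<n]" if "(x, y) \<in> G b" for x y b n
    using that length_branch unfolding G_def br_def cylinder_def
    by (intro nth_equalityI) auto
  have G_inj: "b = b' \<and> x = x'" if G: "(x, y) \<in> G b" "(x', y) \<in> G b'" for x x' y b b'
  proof -
    have "x \<in> K1" "\<phi> x = \<phi> x'" using G unfolding G_def by auto
    moreover have "fst (br b x n) = fst (br b' x' n)" for n using br_eq G by metis
    ultimately have eq: "case_nat b (\<lambda>m. x \<in> B m) = case_nat b' (\<lambda>m. x' \<in> B m)"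
      using branch_inject[OF perf] unfolding br_def by metis
    have "b = b'" using fun_cong[OF eq, of 0] by simp
    moreover have "x = x'" using fun_cong[OF eq, of "Suc _"] by (intro B_sep) simp
    ultimately show ?thesis ..
  qed
  \<comment> \<open>Passing to compact graphs loses mass, but keeping more than half of
    \<open>K\<close> in each of the two copies is enough for the contradiction.\<close>
  have half: "emeasure M K / 2 < emeasure M K"
    using K_pos by (simp add: emeasure_eq_measure ennreal_divide_numeral ennreal_less_iff zero_less_measure_iff)
  obtain r' where r': "emeasure M K / 2 < r'" "r' < emeasure M K" using dense[OF half] by blast
  have "\<exists>H. compact H \<and> H \<subseteq> G b \<and> r' \<le> emeasure M (fst ` H)" for b
    by (rule borel_fst_capacitable[OF _ sets_M G_borel])
      (use r' fst_G K1_eq in \<open>auto simp: emeasure_eq_measure\<close>)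
  then obtain H where H: "\<And>b. compact (H b)" "\<And>b. H b \<subseteq> G b" "\<And>b. r' \<le> emeasure M (fst ` H b)"
    by metis
  have H_eq: "emeasure M (fst ` H b) = emeasure M (snd ` H b)" for b
  proof (rule compact_bijection_preserves[OF H(1)])
    fix x y assume "(x, y) \<in> H b"
    then have "(x, y) \<in> G b" using H(2) by blast
    then have "x \<in> D" "y \<in> D" "\<phi> x = \<phi> y" using K(2) by (auto simp: G_def K1_def)
    then show "E\<^sup>*\<^sup>* x y" using DN E_sym by (metis r_into_rtranclp rtranclp.rtrancl_into_rtrancl)
  next
    fix x y y' assume "(x, y) \<in> H b" "(x, y') \<in> H b"
    then have "(x, y) \<in> G b" "(x, y') \<in> G b" using H(2) by auto
    then show "y = y'" by (intro B_sep) (simp add: code)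
  qed (use G_inj H(2) in blast)
  have H_borel: "snd ` H b \<in> sets M" for b
    using compact_continuous_image[OF continuous_on_snd[OF continuous_on_id] H(1)[of b]]
    by (simp add: compact_imp_closed)
  have "emeasure M K < r' + r'"
    using r'(1) K_pos by (cases r')
      (auto simp: emeasure_eq_measure ennreal_divide_numeral ennreal_less_iff simp flip: ennreal_plus)
  also have "\<dots> \<le> emeasure M (snd ` H True) + emeasure M (snd ` H False)"
    using H(3) H_eq by (metis add_mono)
  also have "\<dots> = emeasure M (snd ` H True \<union> snd ` H False)"
  proof (rule plus_emeasure[OF H_borel H_borel])
    have "False" if "(x, y) \<in> H True" "(x', y) \<in> H False" for x x' y
      using G_inj[of x y True x' False] that H(2) by blast
    then show "snd ` H True \<inter> snd ` H False = {}" by auto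
  qed
  also have "\<dots> \<le> emeasure M K"
  proof (rule emeasure_mono)
    have "snd ` G b \<subseteq> K" for b unfolding G_def by auto
    then show "snd ` H True \<union> snd ` H False \<subseteq> K" using H(2) by blast
  qed simp
  finally show False by simp
qed

end


section \<open>Decomposition into Borel functions\<close>

context pmp_borel_graph begin

text \<open>In a measurable hull of the projection of \<open>R\<close>, the projections of suitable
  compact subsets miss at most \<open>1 / Suc n\<close>. Their union has full measure in the
  hull.\<close>

lemma outer_measure_covered_by_compacts:
  assumes R: "R \<in> sets (borel :: ('a \<times> 'a) measure)"
  shows "\<exists>K N. (\<forall>n::nat. compact (K n)) \<and> (\<forall>n. K n \<subseteq> R) \<and> N \<in> null_sets M \<and>
    fst ` R - N \<subseteq> fst ` (\<Union>n. K n)"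
proof -
  obtain B where B: "B \<in> sets M" "fst ` R \<subseteq> B" "outer_measure_of M (fst ` R) = emeasure M B"
    using outer_measure_of_attain[of "fst ` R" M] by auto
  show ?thesis
  \<comment> \<open>Capacitability needs a value strictly below the outer measure, so the null case
    is separate.\<close>
  proof (cases "measure M B = 0")
    case True
    then have "B \<in> null_sets M" using B(1) by (auto simp: emeasure_eq_measure)
    then show ?thesis using B(2) by (intro exI[of _ "\<lambda>_. {}"] exI[of _ B]) auto
  next
    case False
    then have pos: "measure M B > 0" by (simp add: zero_less_measure_iff)
    have "\<exists>K. compact K \<and> K \<subseteq> R \<and> ennreal (measure M B - 1 / Suc n) \<le> emeasure M (fst ` K)" for n
      using pos B(3)
      by (intro borel_fst_capacitable[OF _ sets_M R]) (auto simp: emeasure_eq_measure intro!: ennreal_lessI)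
    then obtain K where K: "\<And>n. compact (K n)" "\<And>n. K n \<subseteq> R"
      "\<And>n. ennreal (measure M B - 1 / Suc n) \<le> emeasure M (fst ` K n)" by metis
    have "fst ` K n \<in> sets borel" for n
      using compact_continuous_image[OF continuous_on_fst[OF continuous_on_id] K(1)[of n]]
      by (simp add: compact_imp_closed)
    then have F: "fst ` (\<Union>n. K n) \<in> sets M" by (auto simp: image_UN)
    have "measure M B - 1 / Suc n \<le> measure M (fst ` (\<Union>n. K n))" for n
    proof -
      have "ennreal (measure M B - 1 / Suc n) \<le> emeasure M (fst ` (\<Union>n. K n))"
        by (rule order.trans[OF K(3)[of n] emeasure_mono[OF _ F]]) blast
      then show ?thesis by (simp add: emeasure_eq_measure)
    qed
    moreover have "(\<lambda>n. measure M B - 1 / Suc n) \<longlonglongrightarrow> measure M B - 0"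
      by (intro tendsto_intros) (rule LIMSEQ_Suc[OF lim_1_over_n])
    ultimately have "measure M B \<le> measure M (fst ` (\<Union>n. K n))"
      using LIMSEQ_le_const2 by fastforce
    moreover have FB: "fst ` (\<Union>n. K n) \<subseteq> B" using K(2) B(2) by blast
    ultimately have "measure M (B - fst ` (\<Union>n. K n)) \<le> 0"
      using finite_measure_Diff[OF B(1) F] by simp
    then have "B - fst ` (\<Union>n. K n) \<in> null_sets M"
      using B(1) F by (auto simp: emeasure_eq_measure measure_le_0_iff)
    then show ?thesis using K(1,2) B(2) by (intro exI[of _ K] exI[of _ "B - fst ` (\<Union>n. K n)"]) auto
  qed
qed

text \<open>Compact subsets of \<open>R\<close> can be chosen to meet almost every nonempty section.
  What remains has sections smaller by at least one point, so \<open>d\<close> rounds exhaust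
  them.\<close>

lemma bounded_sections_sigma_compact:
  assumes "R \<in> sets (borel :: ('a \<times> 'a) measure)" "\<And>x. finite (R `` {x}) \<and> card (R `` {x}) \<le> d"
  shows "\<exists>K N. (\<forall>n::nat. compact (K n)) \<and> N \<in> null_sets M \<and> (\<forall>x. x \<notin> N \<longrightarrow> R `` {x} = (\<Union>n. K n) `` {x})"
  using assms
proof (induction d arbitrary: R)
  case 0
  have "(x, y) \<notin> R" for x y
  proof -
    have "R `` {x} = {}" using "0.prems"(2)[of x] by (auto simp: card_eq_0_iff)
    then show ?thesis by auto
  qed
  then have "R = {}" by auto
  then show ?case by (intro exI[of _ "\<lambda>_. {}"] exI[of _ "{}"]) auto
next
  case (Suc d)
  obtain K N where K: "\<And>n::nat. compact (K n)" "\<And>n. K n \<subseteq> R" and N: "N \<in> null_sets M"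
    and cov: "fst ` R - N \<subseteq> fst ` (\<Union>n. K n)"
    using outer_measure_covered_by_compacts[OF Suc.prems(1)] by blast
  \<comment> \<open>Emptying the sections over \<open>N\<close> makes the smaller bound hold at
    every point, as the induction hypothesis demands.\<close>
  define R2 where "R2 = (R - (\<Union>n. K n)) \<inter> ((- N) \<times> UNIV)"
  have "N \<in> sets borel" using N by auto
  then have "(- N) \<times> UNIV \<in> sets (borel :: ('a \<times> 'a) measure)"
    unfolding borel_prod[symmetric] by (intro pair_measureI) auto
  then have "R2 \<in> sets borel"
    unfolding R2_def using K(1) Suc.prems(1) by (auto simp: compact_imp_closed)
  moreover have "finite (R2 `` {x}) \<and> card (R2 `` {x}) \<le> d" for x
  proof (cases "x \<in> N \<or> R `` {x} = {}")
    case True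
    then have "R2 `` {x} = {}" unfolding R2_def by auto
    then show ?thesis by simp
  next
    case False
    then have "x \<in> fst ` R - N" by force
    then obtain y where y: "(x, y) \<in> (\<Union>n. K n)" using cov by force
    then have "y \<in> R `` {x}" using K(2) by blast
    have "R2 `` {x} \<subseteq> R `` {x} - {y}" using y unfolding R2_def by auto
    moreover have "finite (R `` {x} - {y})" "card (R `` {x} - {y}) \<le> d"
      using Suc.prems(2)[of x] \<open>y \<in> R `` {x}\<close> by (auto simp: card_Diff_singleton le_diff_conv)
    ultimately show ?thesis by (meson card_mono finite_subset le_trans)
  qed
  ultimately obtain K2 N2 where K2: "\<And>n::nat. compact (K2 n)" "N2 \<in> null_sets M"
    "\<And>x. x \<notin> N2 \<Longrightarrow> R2 `` {x} = (\<Union>n. K2 n) `` {x}"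
    using Suc.IH[of R2] by blast
  have "R `` {x} = (\<Union>n. K n \<union> K2 n) `` {x}" if "x \<notin> N \<union> N2" for x
  proof -
    have "R `` {x} = (\<Union>n. K n) `` {x} \<union> R2 `` {x}"
      using K(2) that unfolding R2_def by blast
    then show ?thesis using K2(3)[of x] that by auto
  qed
  then show ?case
    using K(1) K2(1,2) N
    by (intro exI[of _ "\<lambda>n. K n \<union> K2 n"] exI[of _ "N \<union> N2"]) (auto intro: compact_Un)
qed

text \<open>Lusin-Novikov modulo a null set, for bounded sections: the \<open>n\<close>-th function
  selects the only neighbour in the basic open set \<open>B n\<close>, where there is exactly
  one.\<close>

lemma functional_decomposition_mod_null:
  assumes "AE x in M. degree E x \<le> enat d"
  shows "\<exists>N D f. N \<in> null_sets M \<and> (\<forall>n::nat. D n \<in> sets borel) \<and> (\<forall>n. f n \<in> borel_measurable borel) \<and>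
    (\<forall>n. D n \<inter> N = {}) \<and> (\<forall>x y. x \<notin> N \<longrightarrow> (E x y \<longleftrightarrow> (\<exists>n. x \<in> D n \<and> y = f n x))) \<and>
    (\<forall>x n m. x \<in> D n \<longrightarrow> x \<in> D m \<longrightarrow> f n x = f m x \<longrightarrow> n = m) \<and>
    (\<forall>x. x \<notin> N \<longrightarrow> finite {y. E x y} \<and> card {y. E x y} \<le> d)"
proof -
  obtain N0 where N0: "{x \<in> space M. \<not> degree E x \<le> enat d} \<subseteq> N0" "emeasure M N0 = 0" "N0 \<in> sets M"
    using AE_E[OF assms] by blast
  have fin0: "finite {y. E x y} \<and> card {y. E x y} \<le> d" if "x \<notin> N0" for x
    using that N0(1) by (auto simp: degree_def split: if_splits)
  define R where "R = {p. E (fst p) (snd p)} \<inter> ((- N0) \<times> UNIV)"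
  have "(- N0) \<times> UNIV \<in> sets (borel :: ('a \<times> 'a) measure)"
    using N0(3) unfolding borel_prod[symmetric] by (intro pair_measureI) auto
  then have "R \<in> sets borel" unfolding R_def using E_borel by (auto simp: case_prod_beta')
  have Rx: "R `` {x} = (if x \<in> N0 then {} else {y. E x y})" for x unfolding R_def by auto
  obtain K N1 where K: "\<And>n::nat. compact (K n)" "N1 \<in> null_sets M"
    "\<And>x. x \<notin> N1 \<Longrightarrow> R `` {x} = (\<Union>n. K n) `` {x}"
  proof -
    have "finite (R `` {x}) \<and> card (R `` {x}) \<le> d" for x using fin0 Rx[of x] by simp
    then show thesis using bounded_sections_sigma_compact[OF \<open>R \<in> sets borel\<close>] that by blast
  qed
  define N where "N = N0 \<union> N1"
  define F where "F = (\<Union>n. K n)"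
  have N: "N \<in> null_sets M" unfolding N_def by (rule null_sets.Un[OF null_setsI[OF N0(2,3)] K(2)])
  have [measurable]: "N \<in> sets borel" using N by auto
  have EF: "E x y \<longleftrightarrow> (x, y) \<in> F" if "x \<notin> N" for x y
    using K(3)[of x] that Rx[of x] unfolding F_def N_def by auto
  \<comment> \<open>Points whose section of \<open>F\<close> meets \<open>V\<close>. Since
    \<open>F\<close> is a countable union of compact sets, so is this set for closed
    \<open>V\<close>; hence it is Borel for open \<open>V\<close>.\<close>
  define pr where "pr V = {x. \<exists>y\<in>V. (x, y) \<in> F}" for V
  have pr_closed: "pr V \<in> sets borel" if "closed V" for V
  proof -
    have "pr V = (\<Union>n. fst ` (K n \<inter> UNIV \<times> V))" unfolding pr_def F_def by force
    moreover have "compact (fst ` (K n \<inter> UNIV \<times> V))" for n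
      using that K(1) by (intro compact_continuous_image continuous_intros compact_Int_closed closed_Times) auto
    ultimately show ?thesis by (auto simp: compact_imp_closed)
  qed
  have pr [measurable]: "pr V \<in> sets borel" if V: "open V" for V
  proof -
    obtain C :: "nat \<Rightarrow> 'a set" where C: "\<And>n. closed (C n)" "V = (\<Union>n. C n)"
      using open_eq_UN_closed[OF V] by blast
    have "pr V = (\<Union>n. pr (C n))" unfolding pr_def C(2) by blast
    then show ?thesis using pr_closed C(1) by auto
  qed
  obtain B :: "nat \<Rightarrow> 'a set" where B_open: "\<And>n. open (B n)"
    and B_base: "\<And>U x. open U \<Longrightarrow> x \<in> U \<Longrightarrow> \<exists>n. x \<in> B n \<and> B n \<subseteq> U"
    using separating_open_sequence by blast
  define D0 where "D0 n = {x. x \<notin> N \<and> (\<exists>!y. (x, y) \<in> F \<and> y \<in> B n)}" for n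
  \<comment> \<open>A countable description of uniqueness: two neighbours in \<open>B n\<close>
    would lie in disjoint basic sets.\<close>
  define W where "W n = (pr (B n) - N) - (\<Union>i. \<Union>j\<in>{j. B i \<inter> B j = {}}. pr (B n \<inter> B i) \<inter> pr (B n \<inter> B j))" for n
  have W_iff: "x \<in> W n \<longleftrightarrow> x \<in> pr (B n) \<and> x \<notin> N \<and>
      (\<forall>i j. B i \<inter> B j = {} \<longrightarrow> x \<in> pr (B n \<inter> B i) \<longrightarrow> x \<notin> pr (B n \<inter> B j))" for x n
    unfolding W_def by auto
  have "D0 n = W n" for n
  proof (intro set_eqI iffI)
    fix x assume x: "x \<in> W n"
    then obtain y where y: "y \<in> B n" "(x, y) \<in> F" unfolding W_iff pr_def by blast
    have "y' = y" if y': "y' \<in> B n" "(x, y') \<in> F" for y'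
    proof (rule ccontr)
      assume "y' \<noteq> y"
      then obtain U V where UV: "open U" "open V" "y' \<in> U" "y \<in> V" "U \<inter> V = {}"
        using hausdorff[of y' y] by blast
      obtain i where i: "y' \<in> B i" "B i \<subseteq> U" using B_base[OF UV(1,3)] by blast
      obtain j where j: "y \<in> B j" "B j \<subseteq> V" using B_base[OF UV(2,4)] by blast
      have "B i \<inter> B j = {}" using i j UV(5) by blast
      moreover have "x \<in> pr (B n \<inter> B i)" using y' i unfolding pr_def by blast
      moreover have "x \<in> pr (B n \<inter> B j)" using y j unfolding pr_def by blast
      ultimately show False using x unfolding W_iff by blast
    qed
    then show "x \<in> D0 n" using x y unfolding D0_def W_iff by blast
  next
    fix x assume x: "x \<in> D0 n"
    then obtain y where y: "x \<notin> N" "(x, y) \<in> F" "y \<in> B n" "\<And>y'. (x, y') \<in> F \<Longrightarrow> y' \<in> B n \<Longrightarrow> y' = y"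
      unfolding D0_def by blast
    have "x \<notin> pr (B n \<inter> B j)" if "B i \<inter> B j = {}" "x \<in> pr (B n \<inter> B i)" for i j
    proof
      assume "x \<in> pr (B n \<inter> B j)"
      then have "y \<in> B i" "y \<in> B j" using y(4) that(2) unfolding pr_def by blast+
      then show False using that(1) by blast
    qed
    moreover have "x \<in> pr (B n)" using y unfolding pr_def by blast
    ultimately show "x \<in> W n" using y(1) unfolding W_iff by blast
  qed
  moreover have "W n \<in> sets borel" for n
    unfolding W_def using B_open by (intro sets.Diff sets.countable_UN'' sets.Int pr open_Int) auto
  ultimately have D0 [measurable]: "D0 n \<in> sets borel" for n by simp
  \<comment> \<open>The identity outside \<open>D0 n\<close> is a default that keeps
    \<open>f n\<close> total and Borel.\<close>
  define f where "f n x = (if x \<in> D0 n then (THE y. (x, y) \<in> F \<and> y \<in> B n) else x)" for n x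
  have f: "(x, f n x) \<in> F \<and> f n x \<in> B n" if "x \<in> D0 n" for n x
    using that theI'[of "\<lambda>y. (x, y) \<in> F \<and> y \<in> B n"] unfolding f_def D0_def by auto
  have f_eq: "y = f n x" if "x \<in> D0 n" "(x, y) \<in> F" "y \<in> B n" for n x y
    using that f[OF that(1)] unfolding D0_def by blast
  have f_meas [measurable]: "f n \<in> borel_measurable borel" for n
  proof (rule borel_measurableI)
    fix V :: "'a set" assume V: "open V"
    have "f n -` V \<inter> space borel = (D0 n \<inter> pr (B n \<inter> V)) \<union> (V - D0 n)"
    proof (intro set_eqI iffI)
      fix x assume "x \<in> f n -` V \<inter> space borel"
      then show "x \<in> (D0 n \<inter> pr (B n \<inter> V)) \<union> (V - D0 n)"
        using f[of x n] by (cases "x \<in> D0 n") (auto simp: pr_def f_def)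
    next
      fix x assume "x \<in> (D0 n \<inter> pr (B n \<inter> V)) \<union> (V - D0 n)"
      then show "x \<in> f n -` V \<inter> space borel"
        using f_eq[of x n] by (cases "x \<in> D0 n") (auto simp: pr_def f_def)
    qed
    moreover have "D0 n \<inter> pr (B n \<inter> V) \<union> (V - D0 n) \<in> sets borel"
      using V B_open[of n] by (intro sets.Un sets.Int sets.Diff D0 pr open_Int) auto
    ultimately show "f n -` V \<inter> space borel \<in> sets borel" by simp
  qed
  have E_f: "E x y \<longleftrightarrow> (\<exists>n. x \<in> D0 n \<and> y = f n x)" if x: "x \<notin> N" for x y
  proof
    assume "E x y"
    have "finite {y. E x y}" using x fin0 N_def by blast
    then have "open (- ({y. E x y} - {y}))" by (intro open_Compl finite_imp_closed) auto
    then obtain n where "y \<in> B n" "B n \<subseteq> - ({y. E x y} - {y})" using B_base by blast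
    then have "x \<in> D0 n" using \<open>E x y\<close> EF[OF x] x unfolding D0_def by auto
    then show "\<exists>n. x \<in> D0 n \<and> y = f n x" using f_eq \<open>E x y\<close> EF[OF x] \<open>y \<in> B n\<close> by blast
  qed (use f EF[OF x] in blast)
  \<comment> \<open>Points where an earlier function takes the same value are dropped, so that each
    neighbour is listed once.\<close>
  define D where "D n = D0 n - (\<Union>m\<in>{..<n}. D0 m \<inter> {x \<in> space borel. dist (f m x) (f n x) = 0})" for n
  have "D n \<in> sets borel" for n unfolding D_def by measurable
  moreover have "(\<exists>n. x \<in> D0 n \<and> y = f n x) \<longleftrightarrow> (\<exists>n. x \<in> D n \<and> y = f n x)" for x y
  proof
    assume "\<exists>n. x \<in> D0 n \<and> y = f n x"
    then obtain n where n: "x \<in> D0 n" "y = f n x" "\<And>m. m < n \<Longrightarrow> \<not> (x \<in> D0 m \<and> y = f m x)"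
      using exists_least_iff[of "\<lambda>n. x \<in> D0 n \<and> y = f n x"] by blast
    then have "x \<in> D n" unfolding D_def by (auto dest: sym)
    then show "\<exists>n. x \<in> D n \<and> y = f n x" using n(2) by blast
  qed (auto simp: D_def)
  moreover have "n = m" if "x \<in> D n" "x \<in> D m" "f n x = f m x" for x n m
    using that unfolding D_def by (cases n m rule: linorder_cases) auto
  moreover have "D n \<inter> N = {}" for n unfolding D_def D0_def by blast
  moreover have "finite {y. E x y} \<and> card {y. E x y} \<le> d" if "x \<notin> N" for x
    using that fin0 N_def by blast
  ultimately show ?thesis
    using N f_meas E_f by (intro exI[of _ N] exI[of _ D] exI[of _ f]) auto
qed

end

locale decomposed_pmp_graph = pmp_borel_graph M E
  for M :: "'a::polish_space measure" and E +
  fixes N :: "'a set" and D :: "nat \<Rightarrow> 'a set" and f :: "nat \<Rightarrow> 'a \<Rightarrow> 'a" and d :: nat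
  assumes N_null: "N \<in> null_sets M"
    and D_borel [measurable]: "\<And>n. D n \<in> sets borel"
    and f_meas [measurable]: "\<And>n. f n \<in> borel_measurable borel"
    and D_N: "\<And>n. D n \<inter> N = {}"
    and E_iff: "\<And>x y. x \<notin> N \<Longrightarrow> E x y \<longleftrightarrow> (\<exists>n. x \<in> D n \<and> y = f n x)"
    and f_distinct: "\<And>x n m. x \<in> D n \<Longrightarrow> x \<in> D m \<Longrightarrow> f n x = f m x \<Longrightarrow> n = m"
    and deg_bound: "\<And>x. x \<notin> N \<Longrightarrow> finite {y. E x y} \<and> card {y. E x y} \<le> d"
    and N_saturated: "\<And>x y. x \<notin> N \<Longrightarrow> E x y \<Longrightarrow> y \<notin> N"

text \<open>By \<open>null_target\<close>, adding all vertices with a neighbour in the exceptional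
  set costs no measure. After countably many rounds no edge joins \<open>N\<close> to its
  complement.\<close>

lemma (in pmp_borel_graph) decomposition_exists:
  assumes "AE x in M. degree E x \<le> enat d"
  shows "\<exists>N D f. decomposed_pmp_graph M E N D f d"
proof -
  obtain N0 D f where N0: "N0 \<in> null_sets M" and D [measurable]: "\<And>n::nat. D n \<in> sets borel"
    and f [measurable]: "\<And>n. f n \<in> borel_measurable borel"
    and DN: "\<And>n. D n \<inter> N0 = {}" and Ef: "\<And>x y. x \<notin> N0 \<Longrightarrow> (E x y \<longleftrightarrow> (\<exists>n. x \<in> D n \<and> y = f n x))"
    and dist: "\<And>x n m. x \<in> D n \<Longrightarrow> x \<in> D m \<Longrightarrow> f n x = f m x \<Longrightarrow> n = m"
    and deg: "\<And>x. x \<notin> N0 \<Longrightarrow> finite {y. E x y} \<and> card {y. E x y} \<le> d"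
    using functional_decomposition_mod_null[OF assms] by blast
  define S where "S = rec_nat N0 (\<lambda>_ A. A \<union> (\<Union>n. D n \<inter> f n -` A))"
  have S: "S 0 = N0" "S (Suc k) = S k \<union> (\<Union>n. D n \<inter> f n -` S k)" for k
    unfolding S_def by auto
  have null: "S k \<in> null_sets M" for k
  proof (induction k)
    case (Suc k)
    have [measurable]: "S k \<in> sets borel" using Suc by auto
    have "D n \<inter> f n -` S k \<in> null_sets M" for n
    proof -
      have [measurable]: "D n \<inter> f n -` S k \<in> sets borel"
        using measurable_sets_borel[OF f] by auto
      have "emeasure M (D n \<inter> f n -` S k) = 0"
      proof (rule null_target[OF _ f Suc])
        show "f n x \<in> S k \<and> E x (f n x)" if "x \<in> D n \<inter> f n -` S k" for x
          using that Ef[of x] DN by auto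
      qed measurable
      then show ?thesis by (intro null_setsI) auto
    qed
    then show ?case using Suc unfolding S(2) by (intro null_sets.Un null_sets_UN) auto
  qed (simp add: S N0)
  define N where "N = (\<Union>k. S k)"
  have N: "N \<in> null_sets M" unfolding N_def using null by (rule null_sets_UN)
  then have [measurable]: "N \<in> sets borel" by auto
  have N0N: "N0 \<subseteq> N" unfolding N_def using S(1) by auto
  have "decomposed_pmp_graph M E N (\<lambda>n. D n - N) f d"
  proof
    show "D n - N \<in> sets borel" for n by measurable
    show "y \<notin> N" if xy: "x \<notin> N" "E x y" for x y
    proof
      assume "y \<in> N"
      then obtain k where k: "y \<in> S k" unfolding N_def by blast
      obtain n where "x \<in> D n" "y = f n x" using xy Ef N0N by blast
      then have "x \<in> S (Suc k)" using k unfolding S(2) by auto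
      then show False using xy(1) unfolding N_def by blast
    qed
    show "finite {y. E x y} \<and> card {y. E x y} \<le> d" if "x \<notin> N" for x
      using that deg N0N by blast
    show "E x y \<longleftrightarrow> (\<exists>n. x \<in> D n - N \<and> y = f n x)" if "x \<notin> N" for x y
      using that Ef[of x y] N0N by blast
  qed (use N f dist in auto)
  then show ?thesis by blast
qed


section \<open>The Rayleigh quotient\<close>

lemma suminf_commute_ennreal:
  fixes a :: "nat \<Rightarrow> nat \<Rightarrow> ennreal"
  shows "(\<Sum>n. \<Sum>m. a n m) = (\<Sum>m. \<Sum>n. a n m)"
proof -
  have "(\<Sum>n. \<Sum>m. a n m) = (\<Sum>n. \<integral>\<^sup>+m. a n m \<partial>count_space UNIV)"
    by (simp add: nn_integral_count_space_nat)
  also have "\<dots> = (\<integral>\<^sup>+m. (\<Sum>n. a n m) \<partial>count_space UNIV)"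
    by (rule nn_integral_suminf[symmetric]) simp
  finally show ?thesis by (simp add: nn_integral_count_space_nat)
qed

section \<open>Mass transport between neighbours\<close>

context decomposed_pmp_graph begin

lemma N_borel [measurable]: "N \<in> sets borel"
  using N_null by auto

lemma D_notin_N: "x \<in> D n \<Longrightarrow> x \<notin> N"
  using D_N by blast

lemma sum_neighbours:
  fixes h :: "'a \<Rightarrow> ennreal"
  assumes x: "x \<notin> N"
  shows "(\<Sum>y\<in>{y. E x y}. h y) = (\<Sum>n. h (f n x) * indicator (D n) x)"
proof -
  have inj: "inj_on (\<lambda>n. f n x) {n. x \<in> D n}"
    using f_distinct by (auto intro: inj_onI)
  have img: "(\<lambda>n. f n x) ` {n. x \<in> D n} = {y. E x y}"
    using E_iff[OF x] by auto
  have fin: "finite {n. x \<in> D n}"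
    using deg_bound[OF x] inj img by (metis finite_imageD)
  have "(\<Sum>n. h (f n x) * indicator (D n) x) = (\<Sum>n\<in>{n. x \<in> D n}. h (f n x) * indicator (D n) x)"
    using fin by (rule suminf_finite) auto
  also have "\<dots> = (\<Sum>n\<in>{n. x \<in> D n}. h (f n x))"
    by (intro sum.cong) auto
  also have "\<dots> = (\<Sum>y\<in>{y. E x y}. h y)"
    unfolding img[symmetric] by (simp add: sum.reindex[OF inj])
  finally show ?thesis ..
qed

text \<open>\<open>f n\<close> maps \<open>piece n m\<close> bijectively onto \<open>piece m n\<close> with inverse \<open>f m\<close>, so invariance applies to it
  although the \<open>f n\<close> themselves need not be injective.\<close>

definition piece :: "nat \<Rightarrow> nat \<Rightarrow> 'a set" where
  "piece n m = {x. x \<in> D n \<and> f n x \<in> D m \<and> f m (f n x) = x}"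

lemma piece_borel [measurable]: "piece n m \<in> sets borel"
proof -
  have "{x \<in> space borel. x \<in> D n \<and> f n x \<in> D m \<and> dist (f m (f n x)) x = 0} \<in> sets borel"
    by measurable
  then show ?thesis by (simp add: piece_def)
qed

text \<open>By symmetry \<open>x\<close> is a neighbour of \<open>f n x\<close>, and
  \<open>f n x\<close> lies outside \<open>N\<close>, so exactly one \<open>m\<close> leads back.
  The pieces thus partition \<open>D n\<close>.\<close>

lemma indicator_piece: "(indicator (D n) x :: ennreal) = (\<Sum>m. indicator (piece n m) x)"
proof (cases "x \<in> D n")
  case True
  then have "E x (f n x)" using E_iff D_notin_N by blast
  then have "f n x \<notin> N" "E (f n x) x"
    using N_saturated D_notin_N[OF True] E_sym by blast+
  then obtain m where m: "f n x \<in> D m" "x = f m (f n x)" using E_iff by blast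
  then have eq: "x \<in> piece n k \<longleftrightarrow> k = m" for k
    using True f_distinct[of "f n x" k m] unfolding piece_def by auto
  have "(\<Sum>k. indicator (piece n k) x :: ennreal) = (\<Sum>k\<in>{m}. indicator (piece n k) x)"
    by (rule suminf_finite) (auto simp: eq indicator_def)
  then show ?thesis using True by (simp add: eq indicator_def)
qed (simp add: piece_def)

lemma nn_integral_piece:
  assumes [measurable]: "h \<in> borel_measurable borel"
  shows "(\<integral>\<^sup>+x. h (f n x) * indicator (piece n m) x \<partial>M) = (\<integral>\<^sup>+x. h x * indicator (piece m n) x \<partial>M)"
proof -
  have eq: "distr (density M (indicator (piece n m))) borel (f n) = density M (indicator (piece m n))"
  proof (rule measure_eqI)
    fix A assume "A \<in> sets (distr (density M (indicator (piece n m))) borel (f n))"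
    then have [measurable]: "A \<in> sets borel" by simp
    have vim [measurable]: "f n -` A \<in> sets borel" using measurable_sets_borel[OF f_meas] by auto
    have ind: "emeasure (density M (indicator S)) T = emeasure M (S \<inter> T)"
      if "S \<in> sets borel" "T \<in> sets borel" for S T
      using that by (simp add: emeasure_density flip: indicator_inter_arith)
    have im: "f n ` piece n m = piece m n" "f n ` (piece n m \<inter> f n -` A) = piece m n \<inter> A"
      unfolding piece_def by (auto intro!: image_eqI[where x="f m _"])
    have "emeasure M (f n ` (piece n m \<inter> f n -` A)) = emeasure M (piece n m \<inter> f n -` A)"
    proof (rule pmp_preserves[where D="piece n m" and D'="piece m n" and g="f m"])
      show "E\<^sup>*\<^sup>* x (f n x)" if "x \<in> piece n m" for x
        using that E_iff[of x "f n x"] D_notin_N unfolding piece_def by blast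
    qed (use im in \<open>auto intro: measurable_restrict_space1 simp: piece_def\<close>)
    then show "emeasure (distr (density M (indicator (piece n m))) borel (f n)) A =
        emeasure (density M (indicator (piece m n))) A"
      by (simp add: emeasure_distr ind im)
  qed simp
  have "(\<integral>\<^sup>+x. h (f n x) * indicator (piece n m) x \<partial>M) = (\<integral>\<^sup>+x. h (f n x) \<partial>density M (indicator (piece n m)))"
    by (simp add: nn_integral_density mult.commute)
  also have "\<dots> = (\<integral>\<^sup>+x. h x \<partial>distr (density M (indicator (piece n m))) borel (f n))"
    by (simp add: nn_integral_distr)
  also have "\<dots> = (\<integral>\<^sup>+x. h x * indicator (piece m n) x \<partial>M)"
    unfolding eq by (simp add: nn_integral_density mult.commute)
  finally show ?thesis .
qed

text \<open>Mass transport: exchanging the roles of \<open>n\<close> and \<open>m\<close> turns the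
  neighbour sum of \<open>h\<close> into the degree times \<open>h\<close>.\<close>

lemma nn_integral_neighbours_le:
  assumes [measurable]: "h \<in> borel_measurable borel"
  shows "(\<integral>\<^sup>+x. (\<Sum>y\<in>{y. E x y}. h y) \<partial>M) \<le> of_nat d * (\<integral>\<^sup>+x. h x \<partial>M)"
proof -
  have outside: "AE x in M. x \<notin> N" using N_null by (rule AE_not_in)
  have "(\<integral>\<^sup>+x. (\<Sum>y\<in>{y. E x y}. h y) \<partial>M) = (\<integral>\<^sup>+x. (\<Sum>n. h (f n x) * indicator (D n) x) \<partial>M)"
    by (rule nn_integral_cong_AE) (use outside in eventually_elim, simp add: sum_neighbours)
  also have "\<dots> = (\<Sum>n. \<integral>\<^sup>+x. h (f n x) * indicator (D n) x \<partial>M)"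
    by (rule nn_integral_suminf) measurable
  also have "\<dots> = (\<Sum>n. \<integral>\<^sup>+x. (\<Sum>m. h (f n x) * indicator (piece n m) x) \<partial>M)"
    by (simp add: indicator_piece)
  also have "\<dots> = (\<Sum>n. \<Sum>m. \<integral>\<^sup>+x. h (f n x) * indicator (piece n m) x \<partial>M)"
    by (intro suminf_cong nn_integral_suminf) measurable
  also have "\<dots> = (\<Sum>n. \<Sum>m. \<integral>\<^sup>+x. h x * indicator (piece m n) x \<partial>M)"
    by (simp add: nn_integral_piece)
  also have "\<dots> = (\<Sum>m. \<Sum>n. \<integral>\<^sup>+x. h x * indicator (piece m n) x \<partial>M)"
    by (rule suminf_commute_ennreal)
  also have "\<dots> = (\<Sum>m. \<integral>\<^sup>+x. (\<Sum>n. h x * indicator (piece m n) x) \<partial>M)"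
    by (intro suminf_cong nn_integral_suminf[symmetric]) measurable
  also have "\<dots> = (\<Sum>m. \<integral>\<^sup>+x. h x * indicator (D m) x \<partial>M)"
    by (simp add: indicator_piece)
  also have "\<dots> = (\<integral>\<^sup>+x. (\<Sum>m. h x * indicator (D m) x) \<partial>M)"
    by (rule nn_integral_suminf[symmetric]) measurable
  also have "\<dots> \<le> (\<integral>\<^sup>+x. of_nat d * h x \<partial>M)"
  proof (rule nn_integral_mono_AE, use outside in eventually_elim)
    fix x assume x: "x \<notin> N"
    have "(\<Sum>m. h x * indicator (D m) x) = of_nat (card {y. E x y}) * h x"
      using sum_neighbours[OF x, of "\<lambda>_. h x"] by simp
    also have "\<dots> \<le> of_nat d * h x"
      using deg_bound[OF x] by (intro mult_right_mono) auto
    finally show "(\<Sum>m. h x * indicator (D m) x) \<le> of_nat d * h x" .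
  qed
  also have "\<dots> = of_nat d * (\<integral>\<^sup>+x. h x \<partial>M)"
    by (rule nn_integral_cmult) simp
  finally show ?thesis .
qed

text \<open>With \<open>2|ab| \<le> a^2 + b^2\<close>, twice the quadratic form splits into a degree
  term and a neighbour sum of \<open>u^2\<close>, each at most \<open>d\<close> times the squared
  norm. A non-integrable product has integral 0 by convention, and the bound holds
  trivially.\<close>

lemma rayleigh_le_degree:
  assumes u: "u \<in> L2_nonzero M"
  shows "(\<integral>x. adj_op E u x * u x \<partial>M) / (\<integral>x. (u x)\<^sup>2 \<partial>M) \<le> d"
proof (cases "integrable M (\<lambda>x. adj_op E u x * u x)")
  case True
  have [measurable]: "u \<in> borel_measurable borel" and sq: "integrable M (\<lambda>x. (u x)\<^sup>2)"
    using u unfolding L2_nonzero_def by auto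
  define S where "S x = (\<Sum>y\<in>{y. E x y}. ennreal ((u y)\<^sup>2))" for x
  have sq_eq: "(\<integral>\<^sup>+x. ennreal ((u x)\<^sup>2) \<partial>M) = ennreal (\<integral>x. (u x)\<^sup>2 \<partial>M)"
    using sq by (intro nn_integral_eq_integral) auto
  have outside: "AE x in M. x \<notin> N" using N_null by (rule AE_not_in)
  \<comment> \<open>Neighbourhoods of points in \<open>N\<close> are uncontrolled, so the neighbour
    sum itself may fail to be measurable; the series is a measurable version.\<close>
  have S_meas: "AE x in M. S x = (\<Sum>n. ennreal ((u (f n x))\<^sup>2) * indicator (D n) x)"
    using outside unfolding S_def by eventually_elim (rule sum_neighbours)
  have "ennreal (\<bar>\<integral>x. adj_op E u x * u x \<partial>M\<bar>) \<le> (\<integral>\<^sup>+x. ennreal \<bar>adj_op E u x * u x\<bar> \<partial>M)"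
    using integral_norm_bound_ennreal[OF True] by simp
  then have "2 * ennreal (\<bar>\<integral>x. adj_op E u x * u x \<partial>M\<bar>) \<le> 2 * (\<integral>\<^sup>+x. ennreal \<bar>adj_op E u x * u x\<bar> \<partial>M)"
    by (intro mult_left_mono) auto
  also have "\<dots> = (\<integral>\<^sup>+x. 2 * ennreal \<bar>adj_op E u x * u x\<bar> \<partial>M)"
    by (intro nn_integral_cmult[symmetric] measurable_compose[OF _ measurable_ennreal]
          borel_measurable_abs borel_measurable_integrable[OF True])
  also have "\<dots> \<le> (\<integral>\<^sup>+x. of_nat d * ennreal ((u x)\<^sup>2) + (\<Sum>n. ennreal ((u (f n x))\<^sup>2) * indicator (D n) x) \<partial>M)"
  proof (rule nn_integral_mono_AE, use outside in eventually_elim)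
    fix x assume x: "x \<notin> N"
    have "2 * \<bar>adj_op E u x * u x\<bar> \<le> (\<Sum>y\<in>{y. E x y}. 2 * \<bar>u y\<bar> * \<bar>u x\<bar>)"
      unfolding adj_op_def abs_mult sum_distrib_right[symmetric]
      by (simp add: sum_distrib_left[symmetric] mult_right_mono)
    also have "\<dots> \<le> (\<Sum>y\<in>{y. E x y}. (u x)\<^sup>2 + (u y)\<^sup>2)"
      by (intro sum_mono) (use sum_squares_bound[of "\<bar>u _\<bar>" "\<bar>u x\<bar>"] in \<open>auto simp: algebra_simps\<close>)
    also have "\<dots> = card {y. E x y} * (u x)\<^sup>2 + (\<Sum>y\<in>{y. E x y}. (u y)\<^sup>2)"
      by (simp add: sum.distrib)
    also have "\<dots> \<le> d * (u x)\<^sup>2 + (\<Sum>y\<in>{y. E x y}. (u y)\<^sup>2)"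
      using deg_bound[OF x] by (intro add_right_mono mult_right_mono) auto
    finally have "ennreal (2 * \<bar>adj_op E u x * u x\<bar>) \<le> ennreal (d * (u x)\<^sup>2 + (\<Sum>y\<in>{y. E x y}. (u y)\<^sup>2))"
      by (rule ennreal_leI)
    also have "\<dots> = of_nat d * ennreal ((u x)\<^sup>2) + (\<Sum>y\<in>{y. E x y}. ennreal ((u y)\<^sup>2))"
      by (simp add: ennreal_plus sum_nonneg ennreal_mult ennreal_of_nat_eq_real_of_nat sum_ennreal)
    finally show "2 * ennreal \<bar>adj_op E u x * u x\<bar> \<le>
        of_nat d * ennreal ((u x)\<^sup>2) + (\<Sum>n. ennreal ((u (f n x))\<^sup>2) * indicator (D n) x)"
      using sum_neighbours[OF x, of "\<lambda>y. ennreal ((u y)\<^sup>2)"] by (simp add: ennreal_mult)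
  qed
  also have "\<dots> = of_nat d * (\<integral>\<^sup>+x. ennreal ((u x)\<^sup>2) \<partial>M) +
      (\<integral>\<^sup>+x. (\<Sum>n. ennreal ((u (f n x))\<^sup>2) * indicator (D n) x) \<partial>M)"
    by (subst nn_integral_add) (auto simp: nn_integral_cmult)
  also have "(\<integral>\<^sup>+x. (\<Sum>n. ennreal ((u (f n x))\<^sup>2) * indicator (D n) x) \<partial>M) = (\<integral>\<^sup>+x. S x \<partial>M)"
    by (rule nn_integral_cong_AE) (use S_meas in eventually_elim, simp)
  also have "of_nat d * (\<integral>\<^sup>+x. ennreal ((u x)\<^sup>2) \<partial>M) + (\<integral>\<^sup>+x. S x \<partial>M) \<le>
      of_nat d * (\<integral>\<^sup>+x. ennreal ((u x)\<^sup>2) \<partial>M) + of_nat d * (\<integral>\<^sup>+x. ennreal ((u x)\<^sup>2) \<partial>M)"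
  proof (rule add_left_mono)
    have "(\<lambda>y. ennreal ((u y)\<^sup>2)) \<in> borel_measurable borel" by measurable
    from nn_integral_neighbours_le[OF this]
    show "(\<integral>\<^sup>+x. S x \<partial>M) \<le> of_nat d * (\<integral>\<^sup>+x. ennreal ((u x)\<^sup>2) \<partial>M)" unfolding S_def .
  qed
  also have "\<dots> = ennreal (2 * (d * (\<integral>x. (u x)\<^sup>2 \<partial>M)))"
  proof -
    define I where "I = (\<integral>x. (u x)\<^sup>2 \<partial>M)"
    have I: "0 \<le> I" unfolding I_def by simp
    then have "of_nat d * ennreal I = ennreal (d * I)"
      by (simp add: ennreal_mult ennreal_of_nat_eq_real_of_nat)
    moreover have "ennreal (d * I) + ennreal (d * I) = ennreal (d * I + d * I)"
      by (rule ennreal_plus[symmetric]) (use I in auto)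
    ultimately show ?thesis unfolding sq_eq I_def[symmetric] by (simp only: mult_2)
  qed
  finally have "ennreal (2 * \<bar>\<integral>x. adj_op E u x * u x \<partial>M\<bar>) \<le> ennreal (2 * (d * (\<integral>x. (u x)\<^sup>2 \<partial>M)))"
    by (simp add: ennreal_mult)
  then have "\<bar>\<integral>x. adj_op E u x * u x \<partial>M\<bar> \<le> d * (\<integral>x. (u x)\<^sup>2 \<partial>M)"
    by (subst (asm) ennreal_le_iff) auto
  moreover have nonneg: "0 \<le> (\<integral>x. (u x)\<^sup>2 \<partial>M)" by simp
  ultimately show ?thesis
  proof (cases "(\<integral>x. (u x)\<^sup>2 \<partial>M) = 0")
    case False
    with nonneg have "0 < (\<integral>x. (u x)\<^sup>2 \<partial>M)" by linarith
    moreover have "(\<integral>x. adj_op E u x * u x \<partial>M) \<le> d * (\<integral>x. (u x)\<^sup>2 \<partial>M)"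
      using \<open>\<bar>_\<bar> \<le> _\<close> by linarith
    ultimately show ?thesis by (simp only: pos_divide_le_eq)
  qed (simp only: div_by_0 of_nat_0_le_iff)
qed (simp add: not_integrable_integral_eq)

section \<open>Degrees inside Borel sets\<close>

definition deg_in :: "'a set \<Rightarrow> 'a \<Rightarrow> nat" where
  "deg_in A x = card {y \<in> A. E x y}"

lemma finite_nbrs: "x \<notin> N \<Longrightarrow> finite {y \<in> A. E x y}"
  using deg_bound[of x] by (auto intro: finite_subset[of _ "{y. E x y}"])

lemma deg_in_mono: "x \<notin> N \<Longrightarrow> A \<subseteq> B \<Longrightarrow> deg_in A x \<le> deg_in B x"
  unfolding deg_in_def using finite_nbrs by (intro card_mono) auto

lemma deg_in_le:
  assumes "x \<notin> N"
  shows "deg_in A x \<le> d"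
proof -
  have "deg_in A x \<le> card {y. E x y}"
    unfolding deg_in_def using deg_bound[OF assms] by (intro card_mono) auto
  then show ?thesis using deg_bound[OF assms] by linarith
qed

lemma deg_in_eq:
  assumes x: "x \<notin> N"
  shows "real (deg_in A x) = enn2real (\<Sum>n. indicator A (f n x) * indicator (D n) x)"
proof -
  have "(\<Sum>y\<in>{y. E x y}. indicator A y :: ennreal) = of_nat (card ({y. E x y} \<inter> A))"
    using deg_bound[OF x] by (simp add: indicator_def sum.If_cases Int_def)
  also have "{y. E x y} \<inter> A = {y \<in> A. E x y}" by auto
  finally show ?thesis using sum_neighbours[OF x, of "indicator A"] by (simp add: deg_in_def)
qed

text \<open>The factor \<open>indicator B\<close> removes the points of \<open>N\<close>, outside of
  which the degree is a series of Borel functions.\<close>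

lemma deg_in_measurable:
  assumes [measurable]: "A \<in> sets borel" "B \<in> sets borel" and BN: "B \<inter> N = {}"
  shows "(\<lambda>x. indicator B x * real (deg_in A x)) \<in> borel_measurable borel"
proof -
  have "(\<lambda>x. indicator B x * enn2real (\<Sum>n. indicator A (f n x) * indicator (D n) x)) \<in> borel_measurable borel"
    by measurable
  also have "(\<lambda>x. indicator B x * enn2real (\<Sum>n. indicator A (f n x) * indicator (D n) x)) =
      (\<lambda>x. indicator B x * real (deg_in A x))"
  proof
    show "indicator B x * enn2real (\<Sum>n. indicator A (f n x) * indicator (D n) x) = indicator B x * real (deg_in A x)" for x
    proof (cases "x \<in> B")
      case True
      then have "x \<notin> N" using BN by blast
      then show ?thesis by (simp only: deg_in_eq[OF \<open>x \<notin> N\<close>])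
    qed simp
  qed
  finally show ?thesis .
qed

lemma deg_in_ge_borel:
  assumes [measurable]: "A \<in> sets borel" "B \<in> sets borel" and BN: "B \<inter> N = {}"
  shows "{x \<in> B. k \<le> deg_in A x} \<in> sets borel"
proof -
  note [measurable] = deg_in_measurable[OF assms]
  have "{x \<in> space borel. x \<in> B \<and> real k \<le> indicator B x * real (deg_in A x)} \<in> sets borel"
    by measurable
  also have "{x \<in> space borel. x \<in> B \<and> real k \<le> indicator B x * real (deg_in A x)} = {x \<in> B. k \<le> deg_in A x}"
    by auto
  finally show ?thesis .
qed

lemma has_neighbour_borel:
  assumes "A \<in> sets borel"
  shows "{x. x \<notin> N \<and> (\<exists>y\<in>A. E x y)} \<in> sets borel"
proof -
  have "x \<notin> N \<and> (\<exists>y\<in>A. E x y) \<longleftrightarrow> (\<exists>n. x \<in> D n \<and> f n x \<in> A)" for x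
    using E_iff[of x] D_notin_N[of x] by (cases "x \<in> N") auto
  then have "{x. x \<notin> N \<and> (\<exists>y\<in>A. E x y)} = (\<Union>n. D n \<inter> f n -` A)"
    by auto
  moreover have "f n -` A \<in> sets borel" for n
    using measurable_sets_borel[OF f_meas assms] by simp
  ultimately show ?thesis by auto
qed

text \<open>\<^const>\<open>max_spec\<close> is a supremum of reals, which is unspecified for unbounded sets.\<close>

lemma rayleigh_bdd:
  "bdd_above {(\<integral>x. adj_op E u x * u x \<partial>M) / (\<integral>x. (u x)\<^sup>2 \<partial>M) | u. u \<in> L2_nonzero M}"
proof (rule bdd_aboveI[of _ "real d"])
  fix r assume "r \<in> {(\<integral>x. adj_op E u x * u x \<partial>M) / (\<integral>x. (u x)\<^sup>2 \<partial>M) | u. u \<in> L2_nonzero M}"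
  then obtain u where "u \<in> L2_nonzero M" "r = (\<integral>x. adj_op E u x * u x \<partial>M) / (\<integral>x. (u x)\<^sup>2 \<partial>M)"
    by blast
  then show "r \<le> real d" using rayleigh_le_degree[of u] by (simp only:)
qed

lemma integral_deg_in_le:
  assumes A [measurable]: "A \<in> sets borel" and AN: "A \<inter> N = {}"
  shows "(\<integral>x. indicator A x * real (deg_in A x) \<partial>M) \<le> max_spec M E * measure M A"
proof (cases "measure M A = 0")
  \<comment> \<open>The indicator of a null set is not an admissible test function.\<close>
  case True
  then have "AE x in M. x \<notin> A"
    by (intro AE_not_in) (auto simp: emeasure_eq_measure null_sets_def)
  then have "AE x in M. indicator A x * real (deg_in A x) = 0"
    by eventually_elim simp
  then have "(\<integral>x. indicator A x * real (deg_in A x) \<partial>M) = 0"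
    by (rule integral_eq_zero_AE)
  then show ?thesis using True by simp
next
  case False
  then have pos: "measure M A > 0" by (simp add: zero_less_measure_iff)
  have adj: "adj_op E (indicator A) x * indicator A x = indicator A x * real (deg_in A x)" for x
  proof (cases "x \<in> A")
    case True
    then have "finite {y. E x y}" using AN deg_bound by blast
    then show ?thesis by (simp add: adj_op_def deg_in_def indicator_def sum.If_cases Int_def conj_commute)
  qed simp
  have sq: "(indicator A x :: real)\<^sup>2 = indicator A x" for x by (simp add: indicator_def)
  have L2: "indicator A \<in> L2_nonzero M"
  proof -
    have "\<not> (AE x in M. indicator A x = (0::real))"
    proof
      assume "AE x in M. indicator A x = (0::real)"
      then have "AE x in M. x \<notin> A" by eventually_elim (auto simp: indicator_def split: if_splits)
      then have "emeasure M A = 0" by (simp add: AE_iff_null_sets null_setsD1)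
      then show False using pos by (simp add: emeasure_eq_measure)
    qed
    moreover have "integrable M (indicator A :: 'a \<Rightarrow> real)"
      by (rule integrable_real_indicator) (auto simp: emeasure_eq_measure)
    ultimately show ?thesis unfolding L2_nonzero_def by (auto simp: sq)
  qed
  have "(\<integral>x. adj_op E (indicator A) x * indicator A x \<partial>M) / (\<integral>x. (indicator A x)\<^sup>2 \<partial>M) \<in>
      {(\<integral>x. adj_op E u x * u x \<partial>M) / (\<integral>x. (u x)\<^sup>2 \<partial>M) | u. u \<in> L2_nonzero M}"
    using L2 by blast
  then have "(\<integral>x. adj_op E (indicator A) x * indicator A x \<partial>M) / (\<integral>x. (indicator A x)\<^sup>2 \<partial>M) \<le> max_spec M E"
    unfolding max_spec_def using rayleigh_bdd by (rule cSup_upper)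
  then have "(\<integral>x. indicator A x * real (deg_in A x) \<partial>M) / measure M A \<le> max_spec M E"
    unfolding adj sq by simp
  then show ?thesis using pos by (simp add: divide_le_eq)
qed

text \<open>Keeps \<open>nat\<close> from truncating the floor in \<open>num_colors\<close>, and
  makes the contraction factor of the pruning nonnegative.\<close>

lemma max_spec_nonneg: "0 \<le> max_spec M E"
proof -
  have "measure M (- N) = 1"
    using prob_compl[of N] N_null by (simp add: measure_eq_0_null_sets Compl_eq_Diff_UNIV)
  moreover have "0 \<le> (\<integral>x. indicator (- N) x * real (deg_in (- N) x) \<partial>M)"
    by (intro integral_nonneg_AE) simp
  moreover have "(\<integral>x. indicator (- N) x * real (deg_in (- N) x) \<partial>M) \<le> max_spec M E * measure M (- N)"
    by (rule integral_deg_in_le) auto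
  ultimately show ?thesis by (metis mult.right_neutral order_trans)
qed

end


section \<open>Removing vertices of small degree\<close>

context decomposed_pmp_graph begin

definition num_colors :: nat where
  "num_colors = nat \<lfloor>max_spec M E\<rfloor> + 1"

lemma max_spec_less_num_colors: "max_spec M E < real num_colors"
  unfolding num_colors_def using max_spec_nonneg by linarith

text \<open>One pruning round on the way to what graph theory calls the
  \<open>num_colors\<close>-core.\<close>

definition core :: "'a set \<Rightarrow> 'a set" where
  "core A = {x \<in> A. num_colors \<le> deg_in A x}"

lemma core_borel: "A \<in> sets borel \<Longrightarrow> A \<inter> N = {} \<Longrightarrow> core A \<in> sets borel"
  unfolding core_def by (rule deg_in_ge_borel)

lemma core_subset: "core A \<subseteq> A"
  unfolding core_def by auto

text \<open>Markov's inequality for the degree inside \<open>A\<close>, with its integral bounded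
  through the Rayleigh quotient.\<close>

lemma measure_core_le:
  assumes A [measurable]: "A \<in> sets borel" and AN: "A \<inter> N = {}"
  shows "measure M (core A) \<le> max_spec M E / num_colors * measure M A"
proof -
  have [measurable]: "core A \<in> sets borel" by (rule core_borel[OF A AN])
  have int: "integrable M (\<lambda>x. indicator A x * real (deg_in A x))"
  proof (rule integrable_const_bound[where B="real d"])
    show "AE x in M. norm (indicator A x * real (deg_in A x)) \<le> real d"
      using AN deg_in_le by (intro always_eventually) (auto simp: indicator_def)
  qed (use deg_in_measurable[OF A A AN] in simp)
  have "real num_colors * measure M (core A) = (\<integral>x. real num_colors * indicator (core A) x \<partial>M)"
    by simp
  also have "\<dots> \<le> (\<integral>x. indicator A x * real (deg_in A x) \<partial>M)"
  proof (rule integral_mono[OF _ int])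
    show "integrable M (\<lambda>x. real num_colors * indicator (core A) x)"
      by (intro integrable_mult_right integrable_real_indicator) (auto simp: emeasure_eq_measure)
    show "real num_colors * indicator (core A) x \<le> indicator A x * real (deg_in A x)" for x
      by (auto simp: indicator_def core_def)
  qed
  also have "\<dots> \<le> max_spec M E * measure M A"
    by (rule integral_deg_in_le[OF A AN])
  finally show ?thesis
    using max_spec_less_num_colors max_spec_nonneg by (simp add: pos_le_divide_eq mult.commute)
qed

lemma core_power_borel: "A \<in> sets borel \<Longrightarrow> A \<inter> N = {} \<Longrightarrow>
    (core ^^ n) A \<in> sets borel \<and> (core ^^ n) A \<subseteq> A"
proof (induction n)
  case (Suc n)
  then have "(core ^^ n) A \<inter> N = {}" by blast
  then show ?case using Suc core_borel[of "(core ^^ n) A"] core_subset[of "(core ^^ n) A"] by auto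
qed simp

lemma measure_core_power_le:
  assumes A: "A \<in> sets borel" "A \<inter> N = {}"
  shows "measure M ((core ^^ n) A) \<le> (max_spec M E / num_colors) ^ n"
proof (induction n)
  case (Suc n)
  have "(core ^^ n) A \<in> sets borel" "(core ^^ n) A \<inter> N = {}"
    using core_power_borel[OF A] A(2) by blast+
  then have "measure M ((core ^^ Suc n) A) \<le> max_spec M E / num_colors * measure M ((core ^^ n) A)"
    using measure_core_le by simp
  also have "\<dots> \<le> max_spec M E / num_colors * (max_spec M E / num_colors) ^ n"
    using Suc max_spec_nonneg by (intro mult_left_mono) auto
  finally show ?case by simp
qed simp

section \<open>Greedy Borel colourings\<close>

definition borel_colorable :: "'a set \<Rightarrow> bool" where
  "borel_colorable A \<longleftrightarrow> (\<exists>c \<in> measurable M (count_space (UNIV :: nat set)).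
     (\<forall>x\<in>A. c x < num_colors) \<and> (\<forall>x\<in>A. \<forall>y\<in>A. E x y \<longrightarrow> c x \<noteq> c y))"

text \<open>Each vertex of \<open>J\<close> takes the least colour absent from its neighbours in
  \<open>C\<close>; one below \<open>num_colors\<close> is free by the degree bound. Independence of
  \<open>J\<close> allows all choices to be made simultaneously.\<close>

lemma borel_colorable_Un_independent:
  assumes C [measurable]: "C \<in> sets borel" and J [measurable]: "J \<in> sets borel"
    and JN: "J \<inter> N = {}" and disj: "C \<inter> J = {}"
    and ind: "\<And>x y. x \<in> J \<Longrightarrow> y \<in> J \<Longrightarrow> \<not> E x y"
    and deg: "\<And>x. x \<in> J \<Longrightarrow> deg_in C x < num_colors" and col: "borel_colorable C"
  shows "borel_colorable (C \<union> J)"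
proof -
  obtain c where c [measurable]: "c \<in> measurable M (count_space UNIV)"
    and c_less: "\<And>x. x \<in> C \<Longrightarrow> c x < num_colors" and proper: "\<And>x y. x \<in> C \<Longrightarrow> y \<in> C \<Longrightarrow> E x y \<Longrightarrow> c x \<noteq> c y"
    using col unfolding borel_colorable_def by blast
  define used where "used j = {x. x \<notin> N \<and> (\<exists>y\<in>C \<inter> {x. c x = j}. E x y)}" for j
  have used [measurable]: "used j \<in> sets borel" for j
  proof -
    have "{x \<in> space M. c x = j} \<in> sets M" by measurable
    then show ?thesis unfolding used_def by (intro has_neighbour_borel) auto
  qed
  define c' where "c' x = (if x \<in> J then (LEAST j. x \<notin> used j) else c x)" for x
  have free: "\<exists>j<num_colors. x \<notin> used j" if x: "x \<in> J" for x
  proof (rule ccontr)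
    assume "\<not> (\<exists>j<num_colors. x \<notin> used j)"
    then have "{..<num_colors} \<subseteq> c ` {y \<in> C. E x y}" unfolding used_def by fastforce
    moreover have fin: "finite {y \<in> C. E x y}" using finite_nbrs x JN by blast
    ultimately have "card {..<num_colors} \<le> card (c ` {y \<in> C. E x y})" by (intro card_mono) auto
    also have "\<dots> \<le> deg_in C x" unfolding deg_in_def using fin by (rule card_image_le)
    finally show False using deg[OF x] by simp
  qed
  have c'_J: "c' x < num_colors" "x \<notin> used (c' x)" if x: "x \<in> J" for x
  proof -
    obtain j where j: "j < num_colors" "x \<notin> used j" using free[OF x] by blast
    have eq: "c' x = (LEAST j. x \<notin> used j)" using x by (simp add: c'_def)
    show "x \<notin> used (c' x)" unfolding eq using j(2) by (rule LeastI)
    show "c' x < num_colors" unfolding eq using Least_le[of "\<lambda>j. x \<notin> used j", OF j(2)] j(1) by linarith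
  qed
  have cross: "c' x \<noteq> c' y" if "x \<in> J" "y \<in> C" "E x y" for x y
  proof
    assume eq: "c' x = c' y"
    have "c' y = c y" using that(2) disj unfolding c'_def by auto
    then have "x \<in> used (c' x)" using that eq JN unfolding used_def by auto
    then show False using c'_J(2)[OF that(1)] by blast
  qed
  have c'_C: "c' x = c x" if "x \<in> C" for x using that disj unfolding c'_def by auto
  have "c' \<in> measurable M (count_space UNIV)" unfolding c'_def by measurable
  moreover have "c' x < num_colors" if "x \<in> C \<union> J" for x
    using that c'_J(1) c_less c'_C by auto
  moreover have "c' x \<noteq> c' y" if "x \<in> C \<union> J" "y \<in> C \<union> J" "E x y" for x y
    using that(1,2)
  proof (elim UnE)
    assume "x \<in> C" "y \<in> C"
    then show ?thesis using proper[of x y] that(3) c'_C by simp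
  next
    assume "x \<in> C" "y \<in> J"
    then show ?thesis using cross[of y x] E_sym[OF that(3)] by simp
  next
    assume "x \<in> J" "y \<in> C"
    then show ?thesis using cross[of x y] that(3) by simp
  next
    assume "x \<in> J" "y \<in> J"
    then show ?thesis using ind that(3) by blast
  qed
  ultimately show ?thesis unfolding borel_colorable_def by blast
qed

text \<open>Finite neighbourhoods are closed, so each vertex has a basic open set that avoids its
  neighbours. \<open>I n\<close> keeps the vertices of \<open>B n\<close> without neighbours in
  \<open>B n\<close>.\<close>

lemma independent_cover:
  "\<exists>I :: nat \<Rightarrow> 'a set. (\<forall>n. I n \<in> sets borel) \<and> (\<forall>n. \<forall>x\<in>I n. \<forall>y\<in>I n. \<not> E x y) \<and> (\<Union>n. I n) = - N"
proof -
  obtain B :: "nat \<Rightarrow> 'a set" where B_open: "\<And>n. open (B n)"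
    and B_base: "\<And>U x. open U \<Longrightarrow> x \<in> U \<Longrightarrow> \<exists>n. x \<in> B n \<and> B n \<subseteq> U"
    using separating_open_sequence by blast
  define I where "I n = (B n - N) - {x. x \<notin> N \<and> (\<exists>y\<in>B n. E x y)}" for n
  show ?thesis
  proof (intro exI[of _ I] conjI allI ballI)
    show "I n \<in> sets borel" for n
      unfolding I_def using B_open has_neighbour_borel[of "B n"] by (intro sets.Diff) auto
    show "\<not> E x y" if "x \<in> I n" "y \<in> I n" for n x y using that unfolding I_def by auto
    have "x \<in> (\<Union>n. I n)" if x: "x \<notin> N" for x
    proof -
      have "open (- {y. E x y})" using deg_bound[OF x] by (intro open_Compl finite_imp_closed) auto
      then obtain n where "x \<in> B n" "B n \<subseteq> - {y. E x y}" using B_base[of "- {y. E x y}" x] E_irrefl by auto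
      then have "x \<in> I n" using x unfolding I_def by auto
      then show ?thesis by blast
    qed
    then show "(\<Union>n. I n) = - N" unfolding I_def by auto
  qed
qed

text \<open>The allowed loss makes finitely many independent sets suffice for each layer.\<close>

definition almost_colorable :: "'a set \<Rightarrow> bool" where
  "almost_colorable A \<longleftrightarrow> (\<forall>\<epsilon>>0. \<exists>A'\<in>sets borel. A' \<subseteq> A \<and> borel_colorable A' \<and> measure M (A - A') < \<epsilon>)"

lemma almost_colorableE:
  assumes "almost_colorable A" "\<epsilon> > 0"
  obtains A' where "A' \<in> sets borel" "A' \<subseteq> A" "borel_colorable A'" "measure M (A - A') < \<epsilon>"
  using assms unfolding almost_colorable_def by blast

text \<open>\<open>C\<close> is coloured up to \<open>\<epsilon> / 2\<close>, then finitely many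
  independent slices of \<open>B\<close> are added greedily. The slices exhaust \<open>B\<close>, so
  the rest of \<open>B\<close> is eventually smaller than \<open>\<epsilon> / 2\<close>.\<close>

lemma almost_colorable_Un:
  assumes B [measurable]: "B \<in> sets borel" and C [measurable]: "C \<in> sets borel"
    and BN: "B \<inter> N = {}"
    and deg: "\<And>x. x \<in> B \<Longrightarrow> deg_in (B \<union> C) x < num_colors" and col: "almost_colorable C"
  shows "almost_colorable (B \<union> C)"
  unfolding almost_colorable_def
proof (intro allI impI)
  fix \<epsilon> :: real assume "\<epsilon> > 0"
  then have "\<epsilon> / 2 > 0" by simp
  with col obtain C' where C' [measurable]: "C' \<in> sets borel" and C'_sub: "C' \<subseteq> C" and C'_col: "borel_colorable C'"
    and C'_meas: "measure M (C - C') < \<epsilon> / 2"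
    by (rule almost_colorableE)
  obtain I :: "nat \<Rightarrow> 'a set" where I_all: "(\<forall>n. I n \<in> sets borel) \<and> (\<forall>n. \<forall>x\<in>I n. \<forall>y\<in>I n. \<not> E x y) \<and> (\<Union>n. I n) = - N"
    using independent_cover by (rule exE)
  then have I [measurable]: "I n \<in> sets borel" and I_ind: "x \<in> I n \<Longrightarrow> y \<in> I n \<Longrightarrow> \<not> E x y" for n x y
    by simp_all
  have I_cov: "(\<Union>n. I n) = - N" using I_all by (elim conjE)
  define S where "S m = B \<inter> (\<Union>i\<in>{..<m}. I i)" for m :: nat
  have S [measurable]: "S m \<in> sets borel" for m unfolding S_def by measurable
  have S_col: "borel_colorable (C' \<union> S m)" for m
  proof (induction m)
    case (Suc m)
    have "C' \<union> S (Suc m) = (C' \<union> S m) \<union> ((B \<inter> I m) - (C' \<union> S m))"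
      unfolding S_def by (auto simp: less_Suc_eq)
    moreover have "borel_colorable ((C' \<union> S m) \<union> ((B \<inter> I m) - (C' \<union> S m)))"
    proof (rule borel_colorable_Un_independent)
      show "deg_in (C' \<union> S m) x < num_colors" if "x \<in> (B \<inter> I m) - (C' \<union> S m)" for x
      proof -
        have "x \<in> B" "x \<notin> N" using that BN by auto
        moreover have "C' \<union> S m \<subseteq> B \<union> C" using C'_sub unfolding S_def by auto
        ultimately show ?thesis using deg[of x] deg_in_mono[of x "C' \<union> S m" "B \<union> C"] by linarith
      qed
    qed (use BN I_ind Suc in \<open>auto intro!: sets.Un sets.Int sets.Diff\<close>)
    ultimately show ?case by simp
  qed (simp add: S_def C'_col)
  have "(\<lambda>m. measure M (B - S m)) \<longlonglongrightarrow> measure M (\<Inter>m. B - S m)"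
  proof (rule finite_Lim_measure_decseq)
    have "S m \<subseteq> S n" if "m \<le> n" for m n
      using that unfolding S_def by (intro Int_mono UN_mono) auto
    then show "decseq (\<lambda>m. B - S m)" unfolding decseq_def by blast
  qed auto
  moreover have "(\<Inter>m. B - S m) = {}"
  proof -
    have "\<exists>m. x \<in> S m" if x: "x \<in> B" for x
    proof -
      have "x \<in> (\<Union>n. I n)" unfolding I_cov using x BN by auto
      then obtain n where "x \<in> I n" by blast
      then show ?thesis using x unfolding S_def by (intro exI[of _ "Suc n"]) auto
    qed
    then show ?thesis by blast
  qed
  ultimately have "(\<lambda>m. measure M (B - S m)) \<longlonglongrightarrow> 0" by (simp only: measure_empty)
  then have "\<forall>\<^sub>F m in sequentially. measure M (B - S m) < \<epsilon> / 2"
    using \<open>\<epsilon> > 0\<close> by (intro order_tendstoD) auto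
  then obtain m where m: "measure M (B - S m) < \<epsilon> / 2"
    by (auto simp: eventually_sequentially)
  have "measure M (B \<union> C - (C' \<union> S m)) \<le> measure M ((C - C') \<union> (B - S m))"
    by (intro finite_measure_mono) auto
  also have "\<dots> \<le> measure M (C - C') + measure M (B - S m)"
    by (rule measure_Un_le) auto
  also have "\<dots> < \<epsilon>" using m C'_meas by linarith
  finally show "\<exists>A'\<in>sets borel. A' \<subseteq> B \<union> C \<and> borel_colorable A' \<and> measure M (B \<union> C - A') < \<epsilon>"
    using S_col[of m] C'_sub by (intro bexI[of _ "C' \<union> S m"]) (auto simp: S_def)
qed

text \<open>The induction peels off the innermost application of \<open>core\<close>: the layer
  removed first is coloured last, when the layers inside \<open>core A\<close> have been
  treated.\<close>

lemma almost_colorable_Diff_core: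
  assumes "A \<in> sets borel" "A \<inter> N = {}"
  shows "almost_colorable (A - (core ^^ n) A)"
  using assms
proof (induction n arbitrary: A)
  case 0
  have "borel_colorable {}" unfolding borel_colorable_def by (intro bexI[of _ "\<lambda>_. 0"]) auto
  then show ?case unfolding almost_colorable_def by auto
next
  case (Suc n)
  define A' where "A' = core A"
  have A': "A' \<in> sets borel" "A' \<inter> N = {}" "A' \<subseteq> A"
    using core_borel[OF Suc.prems] core_subset Suc.prems(2) unfolding A'_def by blast+
  have pow: "(core ^^ n) A' \<in> sets borel" "(core ^^ n) A' \<subseteq> A'"
    using core_power_borel[OF A'(1,2)] by blast+
  have "almost_colorable ((A - A') \<union> (A' - (core ^^ n) A'))"
  proof (rule almost_colorable_Un[OF _ _ _ _ Suc.IH[OF A'(1,2)]])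
    show "deg_in (A - A' \<union> (A' - (core ^^ n) A')) x < num_colors" if x: "x \<in> A - A'" for x
    proof -
      have "deg_in A x < num_colors" using x unfolding A'_def core_def by auto
      moreover have "x \<notin> N" using x Suc.prems(2) by blast
      then have "deg_in (A - A' \<union> (A' - (core ^^ n) A')) x \<le> deg_in A x"
        using A'(3) by (intro deg_in_mono) auto
      ultimately show ?thesis by linarith
    qed
  qed (use Suc.prems A' pow in auto)
  moreover have "(A - A') \<union> (A' - (core ^^ n) A') = A - (core ^^ Suc n) A"
    using A'(3) pow(2) unfolding A'_def funpow_Suc_right comp_def by blast
  ultimately show ?case by simp
qed

text \<open>Half of \<open>\<epsilon>\<close> pays for the core left after \<open>n\<close> rounds,
  half for the uncoloured part of the layers; \<open>N\<close> costs nothing.\<close>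

lemma ap_colorable_num_colors: "ap_colorable M E num_colors"
  unfolding ap_colorable_def
proof (intro allI impI)
  fix \<epsilon> :: real assume "\<epsilon> > 0"
  have "(\<lambda>n. (max_spec M E / num_colors) ^ n) \<longlonglongrightarrow> 0"
    using max_spec_nonneg max_spec_less_num_colors by (intro LIMSEQ_realpow_zero) auto
  then have "\<forall>\<^sub>F n in sequentially. (max_spec M E / num_colors) ^ n < \<epsilon> / 2"
    using \<open>\<epsilon> > 0\<close> by (intro order_tendstoD) auto
  then obtain n where n: "(max_spec M E / num_colors) ^ n < \<epsilon> / 2"
    by (auto simp: eventually_sequentially)
  define R where "R = (core ^^ n) (- N)"
  have R: "R \<in> sets borel" "R \<subseteq> - N" "measure M R < \<epsilon> / 2"
    using core_power_borel[of "- N" n] measure_core_power_le[of "- N" n] n unfolding R_def by auto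
  have "almost_colorable (- N - R)" unfolding R_def by (rule almost_colorable_Diff_core) auto
  moreover have "\<epsilon> / 2 > 0" using \<open>\<epsilon> > 0\<close> by simp
  ultimately obtain A where A: "A \<in> sets borel" "A \<subseteq> - N - R" "borel_colorable A"
    "measure M (- N - R - A) < \<epsilon> / 2"
    by (rule almost_colorableE)
  have "measure M (- A) \<le> measure M (N \<union> (R \<union> (- N - R - A)))"
    using A(1) R(1) by (intro finite_measure_mono) auto
  also have "\<dots> \<le> measure M N + (measure M R + measure M (- N - R - A))"
    using A(1) R(1) by (intro order_trans[OF measure_Un_le] add_left_mono measure_Un_le) auto
  also have "\<dots> < \<epsilon>"
    using R(3) A(4) N_null by (simp add: measure_eq_0_null_sets)
  finally have "measure M A > 1 - \<epsilon>"
    using prob_compl[of A] A(1) by (simp add: Compl_eq_Diff_UNIV)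
  moreover have "meas_proper_coloring M E A num_colors"
  proof -
    obtain c where "c \<in> measurable M (count_space (UNIV :: nat set))"
      "\<forall>x\<in>A. c x < num_colors" "\<forall>x\<in>A. \<forall>y\<in>A. E x y \<longrightarrow> c x \<noteq> c y"
      using A(3) unfolding borel_colorable_def by blast
    then show ?thesis
      unfolding meas_proper_coloring_def
      by (intro exI[of _ c]) (auto intro!: measurable_restrict_space1 measurable_completion)
  qed
  ultimately show "\<exists>A. A \<in> sets M \<and> 1 - \<epsilon> < measure M A \<and> meas_proper_coloring M E A num_colors"
    using A(1) by auto
qed

end

theorem theorem5p5:
  fixes M :: "'a::polish_space measure" and E :: "'a \<Rightarrow> 'a \<Rightarrow> bool"
  assumes "standard_prob_space M"
    and "borel_graph E"
    and "bounded_degree M E"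
    and "pmp_graph M E"
  shows "real (chi_ap M E) \<le> of_int \<lfloor>max_spec M E\<rfloor> + 1"
proof -
  interpret pmp_borel_graph M E
    using assms by unfold_locales
  obtain d where "AE x in M. degree E x \<le> enat d"
    using assms(3) unfolding bounded_degree_def by blast
  then obtain N D f where "decomposed_pmp_graph M E N D f d"
    using decomposition_exists by blast
  then interpret decomposed_pmp_graph M E N D f d .
  have "chi_ap M E \<le> num_colors" unfolding chi_ap_def by (rule Least_le) (rule ap_colorable_num_colors)
  then have "real (chi_ap M E) \<le> real num_colors" by simp
  also have "\<dots> = of_int \<lfloor>max_spec M E\<rfloor> + 1" unfolding num_colors_def using max_spec_nonneg by simp
  finally show ?thesis .
qed

end
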